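(* Let $M$ be a connected noncompact smooth manifold of dimension $n$, and let $A$ be a second order locally uniformly elliptic linear differential operator on $M$ with locally bounded coefficients. If $\rho$ is a positive continuous function on $M$, then there exists a real-valued $C^\infty$ function $\varphi$ on $M$ such that $\varphi>\rho$ and $A\varphi>\rho$ on $M$.
   Context: That $A$ is a second order locally uniformly elliptic linear differential operator with locally bounded coefficients means: in local coordinates $(x_1,\dots,x_n)$, $$A=\sum_{i,j=1}^n a_{ij}\frac{\partial^2}{\partial x_i\partial x_j}+\sum_{i=1}^n b_i\frac{\partial}{\partial x_i}+c,$$ where the $a_{ij}$, $b_i$ and $c$ are locally bounded real-valued functions (not assumed continuous) and $(a_{ij})$ is a symmetric matrix-valued function whose eigenvalues are locally bounded below by a positive constant. Manifolds are Hausdorff and second countable. Inequalities are pointwise. *)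

theory Defs
  imports "HOL-Analysis.Analysis"
begin

text \<open>
  Conventions. A manifold is an abstract topology \<open>M\<close> together with its smooth structure, a maximal
  smooth atlas \<open>\<A>\<close>. A chart is a pair \<open>(U, x)\<close> of a domain and a coordinate map; only the values
  of \<open>x\<close> on \<open>U\<close> matter, and \<open>inv_into U x\<close> is the inverse parametrization on \<open>x ` U\<close>.
  The dimension is the cardinality of the finite index type of \<open>real ^ 'n\<close>.
\<close>

section \<open>Smooth functions on open subsets of Euclidean space\<close>

text \<open>
  The derivatives are taken at full neighbourhoods, so these notions are meant for open \<open>S\<close>. The type
  of the iterated directional derivatives stays the same, which makes recursion on the order
  possible; in finite dimension this is the usual class of \<open>k\<close> times continuously differentiable
  functions.
\<close>

primrec Ck_on :: "nat \<Rightarrow> 'a::euclidean_space set \<Rightarrow> ('a \<Rightarrow> 'b::real_normed_vector) \<Rightarrow> bool" where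
  "Ck_on 0 S f \<longleftrightarrow> continuous_on S f"
| "Ck_on (Suc k) S f \<longleftrightarrow>
     (\<forall>x\<in>S. f differentiable at x) \<and> (\<forall>v. Ck_on k S (\<lambda>x. frechet_derivative f (at x) v))"

definition smooth_on :: "'a::euclidean_space set \<Rightarrow> ('a \<Rightarrow> 'b::real_normed_vector) \<Rightarrow> bool" where
  "smooth_on S f \<longleftrightarrow> (\<forall>k. Ck_on k S f)"

definition partial :: "'n::finite \<Rightarrow> (real ^ 'n \<Rightarrow> real) \<Rightarrow> real ^ 'n \<Rightarrow> real" where
  "partial i f y = frechet_derivative f (at y) (axis i 1)"

section \<open>Smooth manifolds\<close>

type_synonym ('m, 'n) chart = "'m set \<times> ('m \<Rightarrow> real ^ 'n)"

definition is_chart :: "'m topology \<Rightarrow> ('m, 'n::finite) chart \<Rightarrow> bool" where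
  "is_chart M = (\<lambda>(U, x).
     openin M U \<and> open (x ` U) \<and> homeomorphic_map (subtopology M U) (top_of_set (x ` U)) x)"

definition smooth_compatible :: "('m, 'n::finite) chart \<Rightarrow> ('m, 'n) chart \<Rightarrow> bool" where
  "smooth_compatible = (\<lambda>(U, x) (V, y).
     smooth_on (x ` (U \<inter> V)) (y \<circ> inv_into U x) \<and>
     smooth_on (y ` (U \<inter> V)) (x \<circ> inv_into V y))"

definition smooth_atlas :: "'m topology \<Rightarrow> ('m, 'n::finite) chart set \<Rightarrow> bool" where
  "smooth_atlas M \<A> \<longleftrightarrow>
     (\<forall>\<kappa>\<in>\<A>. is_chart M \<kappa>) \<and>
     (\<Union>(U, x)\<in>\<A>. U) = topspace M \<and>
     (\<forall>\<kappa>\<in>\<A>. \<forall>\<mu>\<in>\<A>. smooth_compatible \<kappa> \<mu>)"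

definition smooth_structure :: "'m topology \<Rightarrow> ('m, 'n::finite) chart set \<Rightarrow> bool" where
  "smooth_structure M \<A> \<longleftrightarrow>
     smooth_atlas M \<A> \<and>
     (\<forall>\<kappa>. is_chart M \<kappa> \<and> (\<forall>\<mu>\<in>\<A>. smooth_compatible \<kappa> \<mu>) \<longrightarrow> \<kappa> \<in> \<A>)"

definition smooth_manifold :: "'m topology \<Rightarrow> ('m, 'n::finite) chart set \<Rightarrow> bool" where
  "smooth_manifold M \<A> \<longleftrightarrow>
     Hausdorff_space M \<and> second_countable M \<and> smooth_structure M \<A>"

definition smooth_fun :: "('m, 'n::finite) chart set \<Rightarrow> ('m \<Rightarrow> real) \<Rightarrow> bool" where
  "smooth_fun \<A> f \<longleftrightarrow> (\<forall>(U, x)\<in>\<A>. smooth_on (x ` U) (f \<circ> inv_into U x))"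

section \<open>Locally uniformly elliptic operators\<close>

definition locally_bounded_on :: "'a::metric_space set \<Rightarrow> ('a \<Rightarrow> real) \<Rightarrow> bool" where
  "locally_bounded_on S f \<longleftrightarrow> (\<forall>y\<in>S. \<exists>e>0. bounded (f ` (S \<inter> ball y e)))"

definition is_eigenvalue :: "real ^ 'n ^ 'n \<Rightarrow> real \<Rightarrow> bool" where
  "is_eigenvalue Q \<mu> \<longleftrightarrow> (\<exists>v. v \<noteq> 0 \<and> Q *v v = \<mu> *\<^sub>R v)"

definition locally_uniformly_elliptic_on ::
    "(real ^ 'n::finite) set \<Rightarrow> (real ^ 'n \<Rightarrow> real ^ 'n ^ 'n) \<Rightarrow> bool" where
  "locally_uniformly_elliptic_on S a \<longleftrightarrow>
     (\<forall>y\<in>S. transpose (a y) = a y) \<and>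
     (\<forall>y\<in>S. \<exists>e>0. \<exists>\<delta>>0. \<forall>z \<in> S \<inter> ball y e. \<forall>\<mu>. is_eigenvalue (a z) \<mu> \<longrightarrow> \<delta> \<le> \<mu>)"

text \<open>
  The operator maps smooth functions on \<open>M\<close> to arbitrary functions on \<open>M\<close>. In a chart \<open>(U, x)\<close> its
  coefficients are functions on \<open>x ` U\<close>, with no regularity beyond local boundedness.
\<close>

definition elliptic_operator ::
    "('m, 'n::finite) chart set \<Rightarrow> (('m \<Rightarrow> real) \<Rightarrow> 'm \<Rightarrow> real) \<Rightarrow> bool" where
  "elliptic_operator \<A> A \<longleftrightarrow>
     (\<forall>(U, x)\<in>\<A>. \<exists>(a :: real ^ 'n \<Rightarrow> real ^ 'n ^ 'n) (b :: real ^ 'n \<Rightarrow> real ^ 'n)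
                     (c :: real ^ 'n \<Rightarrow> real).
        (\<forall>i j. locally_bounded_on (x ` U) (\<lambda>y. a y $ i $ j)) \<and>
        (\<forall>i. locally_bounded_on (x ` U) (\<lambda>y. b y $ i)) \<and>
        locally_bounded_on (x ` U) c \<and>
        locally_uniformly_elliptic_on (x ` U) a \<and>
        (\<forall>f. smooth_fun \<A> f \<longrightarrow> (\<forall>p\<in>U.
           let F = f \<circ> inv_into U x; y = x p in
           A f p = (\<Sum>i\<in>UNIV. \<Sum>j\<in>UNIV. a y $ i $ j * partial i (partial j F) y)
                 + (\<Sum>i\<in>UNIV. b y $ i * partial i F y)
                 + c y * F y)))"

end

theory Submission
  imports Defs
begin

text \<open>
  Why the theorem holds. A positive bump function \<open>v\<close> on a coordinate ball, with a profile that is steep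
  enough, satisfies \<open>A v \<ge> 2 v\<close> outside an arbitrarily small neighbourhood of the centre of the ball
  (\<open>barrier_in_chart\<close>): the gradient does not vanish there, so for a steep profile the second order term
  dominates all others, whatever the size of the locally bounded coefficients. In the small
  neighbourhood of the centre \<open>A v\<close> may be very negative. This defect can be compensated by adding a large
  multiple of the bump function of a second ball that contains the bad neighbourhood and has its own
  centre elsewhere. This creates a defect near the second centre, which is compensated by a third ball, and
  so on. On a noncompact manifold the balls can march off to infinity, so that the sum is
  locally finite and no defect remains. The result (\<open>escaping_subsolution\<close>) is a smooth function
  \<open>u \<ge> 0\<close>, positive near a prescribed point, with \<open>A u \<ge> u\<close> on the whole manifold.

  Finally a locally finite sum \<open>\<phi>\<close> of large multiples of such functions satisfies \<open>A \<phi> \<ge> \<phi> > \<rho>\<close>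
  (\<open>large_subsolution_exists\<close>). For local finiteness the chains of balls must be chosen such that
  each compact set meets only finitely many of them, even if the manifold has infinitely many ends. This is
  a statement on the nerve of a locally finite cover by balls, which is an infinite, connected, locally
  finite graph: one can start a ray at each vertex such that each vertex lies on finitely
  many rays (\<open>locally_finite_rays\<close>).
\<close>

section \<open>Calculus of \<open>C\<^sup>k\<close> functions\<close>

text \<open>
  The derivatives are taken at full neighbourhoods, so on an open set they only see the values of
  the function there.
\<close>

lemma Ck_on_cong:
  assumes "open S" and "\<And>x. x \<in> S \<Longrightarrow> f x = g x"
  shows "Ck_on k S f \<longleftrightarrow> Ck_on k S g"
proof -
  have one: "Ck_on k S g" if "Ck_on k S f" "\<And>x. x \<in> S \<Longrightarrow> f x = g x" for f g :: "'a \<Rightarrow> 'b"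
    using that
  proof (induction k arbitrary: f g)
    case 0
    then show ?case using continuous_on_cong by (metis Ck_on.simps(1))
  next
    case (Suc k)
    have fr: "(f has_derivative frechet_derivative f (at x)) (at x)" if "x \<in> S" for x
      using Suc.prems(1) that frechet_derivative_works by auto
    have gr: "(g has_derivative frechet_derivative f (at x)) (at x)" if "x \<in> S" for x
      using has_derivative_transform_within_open[OF fr[OF that] assms(1) that] Suc.prems(2) by auto
    have eq: "frechet_derivative f (at x) = frechet_derivative g (at x)" if "x \<in> S" for x
      using gr[OF that] by (rule frechet_derivative_at)
    have "Ck_on k S (\<lambda>x. frechet_derivative g (at x) v)" for v
      by (rule Suc.IH[of "\<lambda>x. frechet_derivative f (at x) v"]) (use Suc.prems eq in auto)
    moreover have "g differentiable at x" if "x \<in> S" for x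
      using gr[OF that] differentiable_def by blast
    ultimately show ?case by simp
  qed
  show ?thesis using one[of f g] one[of g f] assms(2) by auto
qed

lemma Ck_on_SucD: "Ck_on (Suc k) S f \<Longrightarrow> Ck_on k S f"
proof (induction k arbitrary: f)
  case 0
  then have "\<forall>x\<in>S. f differentiable at x" by simp
  then show ?case
    by (simp add: continuous_at_imp_continuous_on differentiable_imp_continuous_within)
next
  case (Suc k)
  from Suc.prems have "\<And>v. Ck_on (Suc k) S (\<lambda>x. frechet_derivative f (at x) v)" by simp
  with Suc.IH have "\<And>v. Ck_on k S (\<lambda>x. frechet_derivative f (at x) v)" by blast
  with Suc.prems show ?case by auto
qed

lemma Ck_on_subset: "Ck_on k S f \<Longrightarrow> T \<subseteq> S \<Longrightarrow> Ck_on k T f"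
  by (induction k arbitrary: f) (auto intro: continuous_on_subset)

lemma Ck_on_SucI:
  assumes "open S"
    and "\<And>x. x \<in> S \<Longrightarrow> (f has_derivative f' x) (at x)"
    and "\<And>v. Ck_on k S (\<lambda>x. f' x v)"
  shows "Ck_on (Suc k) S f"
proof -
  have eq: "f' x = frechet_derivative f (at x)" if "x \<in> S" for x
    using assms(2)[OF that] by (rule frechet_derivative_at)
  have "Ck_on k S (\<lambda>x. frechet_derivative f (at x) v)" for v
    using Ck_on_cong[OF assms(1), of "\<lambda>x. f' x v" "\<lambda>x. frechet_derivative f (at x) v" k] eq assms(3)
    by simp
  moreover have "f differentiable at x" if "x \<in> S" for x
    using assms(2)[OF that] differentiable_def by blast
  ultimately show ?thesis by simp
qed

lemma Ck_on_SucE: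
  assumes "Ck_on (Suc k) S f"
  shows "\<And>x. x \<in> S \<Longrightarrow> (f has_derivative frechet_derivative f (at x)) (at x)"
    and "\<And>v. Ck_on k S (\<lambda>x. frechet_derivative f (at x) v)"
  using assms frechet_derivative_works by auto

lemma Ck_on_local:
  assumes "\<And>x. x \<in> S \<Longrightarrow> \<exists>T. open T \<and> x \<in> T \<and> Ck_on k T f"
  shows "Ck_on k S f"
  using assms
proof (induction k arbitrary: f)
  case 0
  then have "continuous (at x) f" if "x \<in> S" for x
    using that continuous_on_eq_continuous_at by (metis Ck_on.simps(1))
  then show ?case by (simp add: continuous_at_imp_continuous_on)
next
  case (Suc k)
  have "f differentiable at x" if "x \<in> S" for x using Suc.prems[OF that] by auto
  moreover have "Ck_on k S (\<lambda>x. frechet_derivative f (at x) v)" for v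
    by (rule Suc.IH) (use Suc.prems in fastforce)
  ultimately show ?case by simp
qed

lemma Ck_on_const: "open S \<Longrightarrow> Ck_on k S (\<lambda>x. c)"
proof (induction k arbitrary: c)
  case (Suc k)
  show ?case by (rule Ck_on_SucI[where f' = "\<lambda>x v. 0"]) (use Suc in auto)
qed simp

lemma Ck_on_bounded_linear:
  assumes "open S" "bounded_linear L"
  shows "Ck_on k S f \<Longrightarrow> Ck_on k S (\<lambda>x. L (f x))"
proof (induction k arbitrary: f)
  case 0
  then show ?case using assms(2) by (simp add: linear_continuous_on_compose linear_conv_bounded_linear
        bounded_linear.continuous_on)
next
  case (Suc k)
  note d = Ck_on_SucE[OF Suc.prems]
  show ?case
    by (rule Ck_on_SucI[OF assms(1) bounded_linear.has_derivative[OF assms(2) d(1)] Suc.IH[OF d(2)]])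
qed

lemma Ck_on_ident: "open S \<Longrightarrow> Ck_on k S (\<lambda>x. x)"
proof (cases k)
  case (Suc m)
  assume "open S"
  then show ?thesis unfolding Suc
    by (intro Ck_on_SucI[where f' = "\<lambda>x v. v"]) (auto intro: Ck_on_const)
qed simp

lemma Ck_on_add:
  assumes "open S"
  shows "Ck_on k S f \<Longrightarrow> Ck_on k S g \<Longrightarrow> Ck_on k S (\<lambda>x. f x + g x)"
proof (induction k arbitrary: f g)
  case (Suc k)
  note d = Ck_on_SucE[OF Suc.prems(1)] Ck_on_SucE[OF Suc.prems(2)]
  show ?case
    by (rule Ck_on_SucI[OF assms has_derivative_add[OF d(1) d(3)] Suc.IH[OF d(2) d(4)]])
qed (auto intro: continuous_on_add)

lemma Ck_on_sum:
  assumes "open S"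
  shows "(\<And>i. i \<in> I \<Longrightarrow> Ck_on k S (f i)) \<Longrightarrow> Ck_on k S (\<lambda>x. \<Sum>i\<in>I. f i x)"
  by (induction I rule: infinite_finite_induct) (auto intro: assms Ck_on_const Ck_on_add)

lemma Ck_on_scaleR:
  assumes "open S"
  shows "Ck_on k S f \<Longrightarrow> Ck_on k S g \<Longrightarrow> Ck_on k S (\<lambda>x. f x *\<^sub>R g x)"
proof (induction k arbitrary: f g)
  case (Suc k)
  note d = Ck_on_SucE[OF Suc.prems(1)] Ck_on_SucE[OF Suc.prems(2)]
  show ?case
  proof (rule Ck_on_SucI[OF assms])
    show "((\<lambda>x. f x *\<^sub>R g x) has_derivative
        (\<lambda>v. f x *\<^sub>R frechet_derivative g (at x) v + frechet_derivative f (at x) v *\<^sub>R g x)) (at x)"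
      if "x \<in> S" for x
      using that d by (auto intro!: has_derivative_scaleR)
    show "Ck_on k S (\<lambda>x. f x *\<^sub>R frechet_derivative g (at x) v + frechet_derivative f (at x) v *\<^sub>R g x)" for v
      by (intro Ck_on_add assms Suc.IH(1)[OF Ck_on_SucD[OF Suc.prems(1)] d(4)]
          Suc.IH(1)[OF d(2) Ck_on_SucD[OF Suc.prems(2)]])
  qed
qed (auto intro: continuous_on_scaleR)

text \<open>
  Expanding the chain rule \<open>D(g \<circ> f)(x) v = Dg(f x)(Df(x) v)\<close> in the standard basis turns the
  derivative into a sum of products of real \<open>C\<^sup>k\<close> functions with the functions \<open>x \<mapsto> Dg(f x) b\<close>;
  the latter are again compositions, one order of differentiability lower.
\<close>

lemma Ck_on_compose:
  fixes f :: "'a::euclidean_space \<Rightarrow> 'b::euclidean_space" and g :: "'b \<Rightarrow> 'c::real_normed_vector"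
  assumes "open S" "open T"
  shows "Ck_on k S f \<Longrightarrow> Ck_on k T g \<Longrightarrow> f ` S \<subseteq> T \<Longrightarrow> Ck_on k S (\<lambda>x. g (f x))"
proof (induction k arbitrary: f g)
  case 0
  then show ?case by (auto intro: continuous_on_compose2)
next
  case (Suc k)
  note d = Ck_on_SucE[OF Suc.prems(1)] Ck_on_SucE[OF Suc.prems(2)]
  let ?f = "\<lambda>x. frechet_derivative f (at x)" and ?g = "\<lambda>x. frechet_derivative g (at x)"
  show ?case
  proof (rule Ck_on_SucI[OF assms(1)])
    fix x assume x: "x \<in> S"
    then have gx: "(g has_derivative ?g (f x)) (at (f x))" using d Suc.prems by auto
    have "linear (?g (f x))" using gx has_derivative_linear by blast
    then have expand: "?g (f x) w = (\<Sum>b\<in>Basis. (w \<bullet> b) *\<^sub>R ?g (f x) b)" for w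
      by (subst euclidean_representation[of w, symmetric]) (simp add: linear_sum linear_scale)
    from has_derivative_compose[OF d(1)[OF x] gx]
    show "((\<lambda>x. g (f x)) has_derivative (\<lambda>v. \<Sum>b\<in>Basis. (?f x v \<bullet> b) *\<^sub>R ?g (f x) b)) (at x)"
      by (rule has_derivative_eq_rhs) (rule ext, rule expand)
  next
    fix v
    have "Ck_on k S (\<lambda>x. ?f x v \<bullet> b)" for b
      by (rule Ck_on_bounded_linear[OF assms(1) bounded_linear_inner_left d(2)])
    moreover have "Ck_on k S (\<lambda>x. ?g (f x) b)" for b
      by (rule Suc.IH[OF Ck_on_SucD[OF Suc.prems(1)] d(4) Suc.prems(3)])
    ultimately show "Ck_on k S (\<lambda>x. \<Sum>b\<in>Basis. (?f x v \<bullet> b) *\<^sub>R ?g (f x) b)"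
      by (intro Ck_on_sum Ck_on_scaleR assms)
  qed
qed

lemma smooth_on_const: "open S \<Longrightarrow> smooth_on S (\<lambda>_. c)"
  by (simp add: smooth_on_def Ck_on_const)

lemma smooth_on_compose:
  fixes f :: "'a::euclidean_space \<Rightarrow> 'b::euclidean_space"
  assumes "open S" "open T" "smooth_on S f" "smooth_on T g" "f ` S \<subseteq> T"
  shows "smooth_on S (\<lambda>x. g (f x))"
  using assms Ck_on_compose unfolding smooth_on_def by blast

lemma smooth_on_cong:
  "open S \<Longrightarrow> (\<And>x. x \<in> S \<Longrightarrow> f x = g x) \<Longrightarrow> smooth_on S f \<longleftrightarrow> smooth_on S g"
  unfolding smooth_on_def using Ck_on_cong by blast

lemma smooth_on_subset: "smooth_on S f \<Longrightarrow> T \<subseteq> S \<Longrightarrow> smooth_on T f"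
  unfolding smooth_on_def using Ck_on_subset by blast

lemma smooth_on_local:
  assumes "\<And>x. x \<in> S \<Longrightarrow> \<exists>T. open T \<and> x \<in> T \<and> smooth_on T f"
  shows "smooth_on S f"
  using assms Ck_on_local unfolding smooth_on_def by metis

lemma smooth_on_differentiable:
  "smooth_on S f \<Longrightarrow> x \<in> S \<Longrightarrow> f differentiable at x"
  unfolding smooth_on_def using Ck_on.simps(2) by metis

lemma smooth_on_partial: "smooth_on S f \<Longrightarrow> smooth_on S (partial i f)"
  unfolding smooth_on_def partial_def[abs_def] by (metis Ck_on.simps(2))

lemma smooth_on_continuous: "smooth_on S f \<Longrightarrow> continuous_on S f"
  unfolding smooth_on_def by (metis Ck_on.simps(1))

lemma has_derivative_imp_partial:
  "(f has_derivative f') (at y) \<Longrightarrow> partial i f y = f' (axis i 1)"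
  unfolding partial_def by (metis frechet_derivative_at)

lemma partial_cong:
  assumes "open S" "y \<in> S" "\<And>x. x \<in> S \<Longrightarrow> f x = g x" "f differentiable at y"
  shows "partial i f y = partial i g y"
  unfolding partial_def
  using frechet_derivative_transform_within_open[OF assms(4,1,2)] assms(3) by simp

lemma partial_linear_comb:
  assumes "finite I" "\<And>i. i \<in> I \<Longrightarrow> f i differentiable at y"
  shows "partial j (\<lambda>y. \<Sum>i\<in>I. t i * f i y) y = (\<Sum>i\<in>I. t i * partial j (f i) y)"
proof -
  have "((\<lambda>y. \<Sum>i\<in>I. t i * f i y) has_derivative
      (\<lambda>v. \<Sum>i\<in>I. t i * frechet_derivative (f i) (at y) v)) (at y)"
    using assms by (auto intro!: has_derivative_sum has_derivative_mult_right simp: frechet_derivative_works)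
  from has_derivative_imp_partial[OF this] show ?thesis by (simp add: partial_def)
qed

section \<open>Radial bump functions\<close>

text \<open>
  For \<open>n = 0\<close> this is the classical smooth function that is flat at the origin. The factors
  \<open>t\<^sup>-\<^sup>n\<close> make the family closed under differentiation up to linear combinations, so that smoothness
  follows by induction on the order for all \<open>n\<close> at once.
\<close>

definition flat :: "real \<Rightarrow> nat \<Rightarrow> real \<Rightarrow> real" where
  "flat \<beta> n t = (if t > 0 then (1 / t) ^ n * exp (- \<beta> / t) else 0)"

lemma flat_nonneg: "flat \<beta> n t \<ge> 0"
  by (simp add: flat_def)

lemma flat_pos_iff: "flat \<beta> n t > 0 \<longleftrightarrow> t > 0"
  by (simp add: flat_def)

lemma flat_tendsto_0:
  assumes "\<beta> > 0"
  shows "(flat \<beta> n \<longlongrightarrow> 0) (at 0)"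
  unfolding filterlim_split_at_real
proof (rule filterlim_split_at)
  show "(flat \<beta> n \<longlongrightarrow> 0) (at_left 0)"
    by (rule tendsto_eventually) (auto simp: flat_def eventually_at_filter)
  have "((\<lambda>x::real. (\<beta> * x) ^ n / exp (\<beta> * x)) \<longlongrightarrow> 0) at_top"
    by (rule filterlim_compose[OF tendsto_power_div_exp_0])
      (rule filterlim_tendsto_pos_mult_at_top[OF tendsto_const assms filterlim_ident])
  from tendsto_mult_right_zero[OF this, of "inverse (\<beta> ^ n)"]
  have "((\<lambda>x::real. x ^ n * exp (- \<beta> * x)) \<longlongrightarrow> 0) at_top"
    using assms by (simp add: power_mult_distrib exp_minus field_simps)
  then have "((\<lambda>x. flat \<beta> n (inverse x)) \<longlongrightarrow> 0) at_top"
    by (rule Lim_transform_eventually)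
      (use eventually_gt_at_top[of 0] in \<open>eventually_elim, simp add: flat_def divide_simps\<close>)
  then show "(flat \<beta> n \<longlongrightarrow> 0) (at_right 0)"
    by (simp add: filterlim_at_right_to_top)
qed

lemma DERIV_flat:
  assumes "\<beta> > 0"
  shows "(flat \<beta> n has_real_derivative - real n * flat \<beta> (n + 1) t + \<beta> * flat \<beta> (n + 2) t) (at t)"
proof (cases t "0::real" rule: linorder_cases)
  case equal
  have "((\<lambda>y. (flat \<beta> n y - flat \<beta> n 0) / (y - 0)) \<longlongrightarrow> 0) (at 0)"
    \<comment> \<open>The difference quotient at the origin is the next function of the family.\<close>
    by (rule Lim_transform_eventually[OF flat_tendsto_0[OF assms, of "n + 1"]])
      (auto simp: flat_def eventually_at_filter)
  then show ?thesis by (simp add: has_field_derivative_iff equal flat_def)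
next
  case less
  show ?thesis
    by (rule has_field_derivative_transform_within_open[where f = "\<lambda>_. 0" and S = "{..<0}"])
      (use less in \<open>auto simp: flat_def\<close>)
next
  case greater
  have "((\<lambda>t. 1 / t) has_real_derivative - ((1 / t) ^ 2)) (at t)"
    using greater by (auto intro!: derivative_eq_intros simp: power2_eq_square)
  from DERIV_power[OF this, of n]
  have pow: "((\<lambda>t. (1 / t) ^ n) has_real_derivative real n * - ((1 / t) ^ (n + 1))) (at t)"
    by (rule DERIV_cong) (cases n, auto simp: power2_eq_square)
  have "((\<lambda>t. exp (- \<beta> / t)) has_real_derivative \<beta> * (1 / t) ^ 2 * exp (- \<beta> / t)) (at t)"
    using greater by (auto intro!: derivative_eq_intros simp: power2_eq_square)
  from DERIV_mult[OF pow this]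
  have "((\<lambda>t. (1 / t) ^ n * exp (- \<beta> / t)) has_real_derivative
      - real n * flat \<beta> (n + 1) t + \<beta> * flat \<beta> (n + 2) t) (at t)"
    by (rule DERIV_cong) (use greater in \<open>simp add: flat_def power_add power2_eq_square mult_ac\<close>)
  then show ?thesis
    by (rule has_field_derivative_transform_within_open[where S = "{0<..}"])
      (use greater in \<open>auto simp: flat_def\<close>)
qed

lemma smooth_on_flat:
  assumes "\<beta> > 0"
  shows "smooth_on UNIV (flat \<beta> n)"
  unfolding smooth_on_def
proof
  fix k
  show "Ck_on k UNIV (flat \<beta> n)"
  proof (induction k arbitrary: n)
    case 0
    show ?case using DERIV_flat[OF assms] by (auto intro!: continuous_at_imp_continuous_on DERIV_isCont)
  next
    case (Suc k)
    show ?case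
    proof (rule Ck_on_SucI)
      show "(flat \<beta> n has_derivative
          (\<lambda>v. (- real n * v) *\<^sub>R flat \<beta> (n + 1) t + (\<beta> * v) *\<^sub>R flat \<beta> (n + 2) t)) (at t)" for t
        using DERIV_flat[OF assms, of n t]
        unfolding has_field_derivative_def by (rule has_derivative_eq_rhs) (auto simp: algebra_simps)
    qed (intro open_UNIV Ck_on_add Ck_on_scaleR Ck_on_const Suc.IH)+
  qed
qed

definition bump :: "real \<Rightarrow> real \<Rightarrow> 'a::euclidean_space \<Rightarrow> 'a \<Rightarrow> real" where
  "bump \<beta> R q y = flat \<beta> 0 (R\<^sup>2 - (y - q) \<bullet> (y - q))"

lemma smooth_on_bump:
  assumes "\<beta> > 0"
  shows "smooth_on UNIV (bump \<beta> R q)"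
proof -
  have "smooth_on UNIV (\<lambda>y. R\<^sup>2 + (- 1) *\<^sub>R (\<Sum>b\<in>Basis. ((y + - q) \<bullet> b) *\<^sub>R ((y + - q) \<bullet> b)))"
    unfolding smooth_on_def
    by (intro allI Ck_on_add Ck_on_const open_UNIV Ck_on_scaleR Ck_on_sum Ck_on_ident
        Ck_on_bounded_linear[OF _ bounded_linear_inner_left])
  then have s: "smooth_on UNIV (\<lambda>y. R\<^sup>2 - (y - q) \<bullet> (y - q))"
    by (simp add: euclidean_inner[symmetric])
  show ?thesis unfolding bump_def[abs_def]
    by (rule smooth_on_compose[OF open_UNIV open_UNIV s smooth_on_flat[OF assms]]) simp
qed

lemma partial_bump:
  assumes "\<beta> > 0"
  shows "partial j (bump \<beta> R q) y = - 2 * \<beta> * (y - q) $ j * flat \<beta> 2 (R\<^sup>2 - (y - q) \<bullet> (y - q))"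
proof -
  let ?s = "R\<^sup>2 - (y - q) \<bullet> (y - q)"
  have "((\<lambda>y. R\<^sup>2 - (y - q) \<bullet> (y - q)) has_derivative (\<lambda>v. - 2 * ((y - q) \<bullet> v))) (at y)"
    by (auto intro!: derivative_eq_intros simp: inner_commute)
  note DERIV_compose_FDERIV[OF DERIV_flat[OF assms, of 0] this]
  then have "((\<lambda>y. flat \<beta> 0 (R\<^sup>2 - (y - q) \<bullet> (y - q))) has_derivative
      (\<lambda>v. - 2 * ((y - q) \<bullet> v) * (\<beta> * flat \<beta> 2 ?s))) (at y)"
    by (rule has_derivative_eq_rhs) (simp add: fun_eq_iff numeral_2_eq_2 numeral_3_eq_3)
  from has_derivative_imp_partial[OF this, of j] show ?thesis
    unfolding bump_def[abs_def] inner_axis inner_real_def mult_1_right by (simp only: mult_ac)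
qed

lemma partial_partial_bump:
  assumes "\<beta> > 0"
  shows "partial i (partial j (bump \<beta> R q)) y =
    4 * \<beta> * (\<beta> * flat \<beta> 4 (R\<^sup>2 - (y - q) \<bullet> (y - q)) - 2 * flat \<beta> 3 (R\<^sup>2 - (y - q) \<bullet> (y - q)))
      * (y - q) $ i * (y - q) $ j
    - (if i = j then 2 * \<beta> * flat \<beta> 2 (R\<^sup>2 - (y - q) \<bullet> (y - q)) else 0)"
proof -
  let ?s = "R\<^sup>2 - (y - q) \<bullet> (y - q)"
  have "((\<lambda>y. R\<^sup>2 - (y - q) \<bullet> (y - q)) has_derivative (\<lambda>v. - 2 * ((y - q) \<bullet> v))) (at y)"
    by (auto intro!: derivative_eq_intros simp: inner_commute)
  note DERIV_compose_FDERIV[OF DERIV_flat[OF assms, of 2] this]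
  then have flat: "((\<lambda>y. flat \<beta> 2 (R\<^sup>2 - (y - q) \<bullet> (y - q))) has_derivative
      (\<lambda>v. - 2 * ((y - q) \<bullet> v) * (\<beta> * flat \<beta> 4 ?s - 2 * flat \<beta> 3 ?s))) (at y)"
    by (rule has_derivative_eq_rhs) (simp add: fun_eq_iff eval_nat_numeral)
  have lin: "((\<lambda>y. - 2 * \<beta> * (y - q) $ j) has_derivative (\<lambda>v. - 2 * \<beta> * v $ j)) (at y)"
    by (auto intro!: derivative_eq_intros bounded_linear.has_derivative[OF bounded_linear_vec_nth])
  have "partial j (bump \<beta> R q) =
      (\<lambda>y. - 2 * \<beta> * (y - q) $ j * flat \<beta> 2 (R\<^sup>2 - (y - q) \<bullet> (y - q)))"
    using partial_bump[OF assms] by blast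
  then have "partial i (partial j (bump \<beta> R q)) y =
      partial i (\<lambda>y. - 2 * \<beta> * (y - q) $ j * flat \<beta> 2 (R\<^sup>2 - (y - q) \<bullet> (y - q))) y"
    by simp
  also have "\<dots> = - 2 * \<beta> * (y - q) $ j *
        (- 2 * ((y - q) \<bullet> axis i 1) * (\<beta> * flat \<beta> 4 ?s - 2 * flat \<beta> 3 ?s))
      + - 2 * \<beta> * axis i 1 $ j * flat \<beta> 2 ?s"
    by (rule has_derivative_imp_partial[OF has_derivative_mult[OF lin flat]])
  also have "\<dots> = 4 * \<beta> * (\<beta> * flat \<beta> 4 ?s - 2 * flat \<beta> 3 ?s) * (y - q) $ i * (y - q) $ j
      - (if i = j then 2 * \<beta> * flat \<beta> 2 ?s else 0)"
  proof -
    have *: "- 2 * \<beta> * r * (- 2 * p * (\<beta> * f4 - 2 * f3)) + - 2 * \<beta> * d * f2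
        = 4 * \<beta> * (\<beta> * f4 - 2 * f3) * p * r - d * (2 * \<beta> * f2)" for p r d f2 f3 f4 :: real
      by (simp add: algebra_simps)
    show ?thesis unfolding inner_axis inner_real_def mult_1_right * by (simp add: axis_def)
  qed
  finally show ?thesis .
qed

definition diff_op ::
  "(real ^ 'n \<Rightarrow> real ^ 'n ^ 'n) \<Rightarrow> (real ^ 'n \<Rightarrow> real ^ 'n) \<Rightarrow> (real ^ 'n \<Rightarrow> real)
    \<Rightarrow> (real ^ 'n::finite \<Rightarrow> real) \<Rightarrow> real ^ 'n \<Rightarrow> real" where
  "diff_op a b c F y = (\<Sum>i\<in>UNIV. \<Sum>j\<in>UNIV. a y $ i $ j * partial i (partial j F) y)
     + (\<Sum>i\<in>UNIV. b y $ i * partial i F y) + c y * F y"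

text \<open>
  With \<open>z = y - q\<close> and \<open>s = R\<^sup>2 - |z|\<^sup>2\<close>, the bump is \<open>h s\<close> for \<open>h = flat \<beta> 0\<close>, the gradient of \<open>s\<close>
  is \<open>- 2 z\<close> and its Hessian is \<open>- 2\<close> times the identity. The three summands are
  \<open>4 h'' (z \<bullet> a z)\<close>, \<open>- 2 h' (tr a + b \<bullet> z)\<close> and \<open>c h\<close>.
\<close>

lemma diff_op_bump:
  fixes y q :: "real ^ 'n::finite" and R :: real
  assumes "\<beta> > 0"
  defines "z \<equiv> y - q"
  defines "s \<equiv> R\<^sup>2 - z \<bullet> z"
  shows "diff_op a b c (bump \<beta> R q) y =
    4 * \<beta> * (\<beta> * flat \<beta> 4 s - 2 * flat \<beta> 3 s) * (z \<bullet> (a y *v z))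
    - 2 * \<beta> * flat \<beta> 2 s * ((\<Sum>i\<in>UNIV. a y $ i $ i) + b y \<bullet> z) + c y * flat \<beta> 0 s"
proof -
  let ?A = "4 * \<beta> * (\<beta> * flat \<beta> 4 s - 2 * flat \<beta> 3 s)" and ?B = "2 * \<beta> * flat \<beta> 2 s"
  have pp: "partial i (partial j (bump \<beta> R q)) y = ?A * z $ i * z $ j - (if i = j then ?B else 0)" for i j
    unfolding z_def s_def by (rule partial_partial_bump[OF assms(1)])
  have p: "partial j (bump \<beta> R q) y = - ?B * z $ j" for j
    unfolding z_def s_def partial_bump[OF assms(1)] by simp
  have "(\<Sum>i\<in>UNIV. \<Sum>j\<in>UNIV. a y $ i $ j * partial i (partial j (bump \<beta> R q)) y)
      = (\<Sum>i\<in>UNIV. \<Sum>j\<in>UNIV. ?A * (z $ i * (a y $ i $ j * z $ j)) - (if i = j then ?B * a y $ i $ i else 0))"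
    unfolding pp by (intro sum.cong refl) (auto simp: algebra_simps)
  also have "\<dots> = ?A * (z \<bullet> (a y *v z)) - ?B * (\<Sum>i\<in>UNIV. a y $ i $ i)"
    by (simp add: sum_subtractf sum_distrib_left inner_vec_def matrix_vector_mult_def)
  finally have 1: "(\<Sum>i\<in>UNIV. \<Sum>j\<in>UNIV. a y $ i $ j * partial i (partial j (bump \<beta> R q)) y) = \<dots>" .
  have 2: "(\<Sum>i\<in>UNIV. b y $ i * partial i (bump \<beta> R q) y) = - ?B * (b y \<bullet> z)"
    unfolding p by (simp add: inner_vec_def sum_distrib_left sum_negf algebra_simps)
  have "bump \<beta> R q y = flat \<beta> 0 s" by (simp add: bump_def s_def z_def)
  with 1 2 show ?thesis unfolding diff_op_def by (simp add: algebra_simps)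
qed

text \<open>
  The reason why the bump is a subsolution away from its centre: for \<open>h = flat \<beta> 0\<close> and \<open>X = \<beta> / t\<^sup>2\<close> one
  has \<open>h' = X h\<close>, while \<open>h''\<close> is at least \<open>X\<^sup>2 h / 2\<close> once \<open>\<beta>\<close> is large compared with \<open>R\<close>. On
  \<open>0 < t \<le> R\<close> the quantity \<open>X\<close> is at least \<open>\<beta> / R\<^sup>2\<close>, so for large \<open>\<beta>\<close> the second derivative beats
  any fixed multiple of \<open>h'\<close> and of \<open>h\<close>, uniformly in \<open>t\<close>. This includes small \<open>t\<close>, where all terms
  tend to \<open>0\<close>. Here \<open>e\<close> stands for \<open>z \<bullet> a z\<close>, \<open>w\<close> for \<open>tr a + b \<bullet> z\<close> and \<open>k\<close> for \<open>c\<close>.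
\<close>

lemma flat_dominates:
  fixes K \<delta> R :: real
  assumes "\<delta> > 0" "R > 0" "K \<ge> 0"
  obtains \<beta> where "\<beta> > 0"
    "\<And>t e w k. \<lbrakk>t \<le> R; \<delta> \<le> e; \<bar>w\<bar> \<le> K; \<bar>k\<bar> \<le> K\<rbrakk> \<Longrightarrow>
      2 * flat \<beta> 0 t \<le>
        4 * \<beta> * (\<beta> * flat \<beta> 4 t - 2 * flat \<beta> 3 t) * e - 2 * \<beta> * flat \<beta> 2 t * w + k * flat \<beta> 0 t"
proof -
  \<comment> \<open>With \<open>u = 1 / t \<ge> 1 / R\<close> and \<open>X = \<beta> u\<^sup>2\<close>, the first entry gives \<open>\<beta> u \<ge> 4\<close>, hence \<open>\<beta> u - 2 \<ge> \<beta> u / 2\<close>;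
    the second one gives \<open>X \<ge> 1\<close> and \<open>2 \<delta> X \<ge> 3 K + 2\<close>, so that \<open>2 \<delta> X\<^sup>2 \<ge> 2 K X + K + 2\<close>.\<close>
  define \<beta> where "\<beta> = max (4 * R) (R\<^sup>2 * max 1 ((3 * K + 2) / (2 * \<delta>)))"
  have \<beta>: "\<beta> > 0" using assms by (simp add: \<beta>_def)
  show thesis
  proof (rule that[OF \<beta>])
    fix t e w k :: real
    assume *: "t \<le> R" "\<delta> \<le> e" "\<bar>w\<bar> \<le> K" "\<bar>k\<bar> \<le> K"
    show "2 * flat \<beta> 0 t \<le>
        4 * \<beta> * (\<beta> * flat \<beta> 4 t - 2 * flat \<beta> 3 t) * e - 2 * \<beta> * flat \<beta> 2 t * w + k * flat \<beta> 0 t"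
    proof (cases "t > 0")
      case False
      then show ?thesis by (simp add: flat_def)
    next
      case True
      define u where "u = 1 / t"
      define X where "X = \<beta> * u\<^sup>2"
      have u: "u > 0" "1 / R \<le> u" using True * by (auto simp: u_def frac_le)
      have "4 \<le> \<beta> * (1 / R)" using assms by (simp add: \<beta>_def field_simps)
      also have "\<dots> \<le> \<beta> * u" using u \<beta> by (intro mult_left_mono) auto
      finally have bu: "4 \<le> \<beta> * u" .
      have "R\<^sup>2 * max 1 ((3 * K + 2) / (2 * \<delta>)) \<le> \<beta>" by (simp add: \<beta>_def)
      then have "max 1 ((3 * K + 2) / (2 * \<delta>)) \<le> \<beta> * (1 / R)\<^sup>2"
        using assms by (simp only: power_one_over times_divide_eq_right mult_1_right
            pos_le_divide_eq zero_less_power mult.commute)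
      also have "\<dots> \<le> X" unfolding X_def using u \<beta> assms by (intro mult_left_mono power_mono) auto
      finally have X: "1 \<le> X" "3 * K + 2 \<le> 2 * \<delta> * X" using assms by (auto simp: field_simps)
      have "2 * X\<^sup>2 = 4 * \<beta> * u ^ 3 * (\<beta> * u / 2)"
        by (simp add: X_def power2_eq_square power3_eq_cube)
      also have "\<dots> \<le> 4 * \<beta> * u ^ 3 * (\<beta> * u - 2)"
        using bu u \<beta> by (intro mult_left_mono) auto
      also have "\<dots> = 4 * \<beta> * (\<beta> * u ^ 4 - 2 * u ^ 3)"
        by (simp add: algebra_simps power4_eq_xxxx power3_eq_cube)
      finally have A: "2 * X\<^sup>2 \<le> 4 * \<beta> * (\<beta> * u ^ 4 - 2 * u ^ 3)" .
      have "2 * X\<^sup>2 * \<delta> \<le> 4 * \<beta> * (\<beta> * u ^ 4 - 2 * u ^ 3) * e"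
        using A * assms by (intro mult_mono[OF A *(2)] order_trans[OF _ A]) auto
      moreover have "(3 * K + 2) * X \<le> 2 * \<delta> * X * X" using X by (intro mult_right_mono) auto
      moreover have "(K + 2) * 1 \<le> (K + 2) * X" using X assms by (intro mult_left_mono) auto
      moreover have "X * w \<le> X * K" using X * by (intro mult_left_mono) auto
      moreover have "- k \<le> K" using * by auto
      ultimately have "0 \<le> 4 * \<beta> * (\<beta> * u ^ 4 - 2 * u ^ 3) * e - 2 * X * w + k - 2"
        by (simp add: algebra_simps power2_eq_square)
      then have "0 \<le> (4 * \<beta> * (\<beta> * u ^ 4 - 2 * u ^ 3) * e - 2 * X * w + k - 2) * exp (- \<beta> / t)"
        by simp
      also have "\<dots> = 4 * \<beta> * (\<beta> * flat \<beta> 4 t - 2 * flat \<beta> 3 t) * e - 2 * \<beta> * flat \<beta> 2 t * w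
          + k * flat \<beta> 0 t - 2 * flat \<beta> 0 t"
        using True unfolding X_def flat_def u_def[symmetric] by (simp add: algebra_simps)
      finally show ?thesis by simp
    qed
  qed
qed

section \<open>Ellipticity and boundedness on compact sets\<close>

text \<open>
  The minimum \<open>m\<close> of the quadratic form on the unit sphere, attained at \<open>w\<close> say, is an eigenvalue:
  \<open>Q - m\<close> is positive semidefinite and vanishes at \<open>w\<close>, so the first variation at \<open>w\<close> in every
  direction vanishes, which means \<open>Q w = m w\<close>. Hence \<open>\<delta> \<le> m\<close>.
\<close>

lemma quadratic_form_ge_if_eigenvalues_ge:
  fixes Q :: "real ^ 'n ^ 'n::finite"
  assumes sym: "transpose Q = Q" and ev: "\<And>\<mu>. is_eigenvalue Q \<mu> \<Longrightarrow> \<delta> \<le> \<mu>"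
  shows "\<delta> * (v \<bullet> v) \<le> v \<bullet> (Q *v v)"
proof -
  let ?q = "\<lambda>v. v \<bullet> (Q *v v)"
  have "continuous_on (sphere (0 :: real ^ 'n) 1) ?q"
    by (intro continuous_intros linear_continuous_on matrix_vector_mul_bounded_linear)
  moreover have "sphere (0 :: real ^ 'n) 1 \<noteq> {}" by simp
  ultimately obtain w where w: "norm w = 1" and wmin: "\<And>u. norm u = 1 \<Longrightarrow> ?q w \<le> ?q u"
    using continuous_attains_inf[of "sphere (0 :: real ^ 'n) 1" ?q] by auto
  define m where "m = ?q w"
  have ww: "w \<bullet> w = 1" using w by (simp add: dot_square_norm)
  have sa: "u \<bullet> (Q *v v) = v \<bullet> (Q *v u)" for u v
    by (metis dot_lmul_matrix inner_commute sym transpose_matrix_vector)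
  have q_ge: "m * (u \<bullet> u) \<le> ?q u" for u
  proof (cases "u = 0")
    case False
    then have "m \<le> ?q (u /\<^sub>R norm u)" unfolding m_def by (intro wmin) simp
    also have "\<dots> = ?q u / (u \<bullet> u)"
      by (simp add: matrix_vector_mult_scaleR dot_square_norm power2_eq_square divide_inverse)
    finally show ?thesis using False by (simp add: pos_le_divide_eq)
  qed simp
  have "u \<bullet> (Q *v w - m *\<^sub>R w) = 0" for u
  proof -
    define p where "p = u \<bullet> (Q *v w - m *\<^sub>R w)"
    define r where "r = ?q u - m * (u \<bullet> u)"
    have *: "0 \<le> 2 * t * p + t\<^sup>2 * r" for t
    proof -
      have "0 \<le> ?q (w + t *\<^sub>R u) - m * ((w + t *\<^sub>R u) \<bullet> (w + t *\<^sub>R u))" using q_ge by simp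
      also have "\<dots> = 2 * t * p + t\<^sup>2 * r"
        unfolding p_def r_def using ww sa[of w u]
        by (simp add: matrix_vector_right_distrib matrix_vector_mult_scaleR inner_add_left inner_add_right
            inner_diff_right m_def inner_commute[of w u] power2_eq_square algebra_simps)
      finally show ?thesis .
    qed
    have "r \<ge> 0" using q_ge by (simp add: r_def)
    \<comment> \<open>The choice \<open>t = - p / (r + 1)\<close> makes the nonnegative expression \<open>2 t p + t\<^sup>2 r\<close> equal to
      \<open>- t\<^sup>2 (r + 2)\<close>, which forces \<open>t = 0\<close>.\<close>
    define t where "t = - p / (r + 1)"
    have p: "p = - t * (r + 1)" using \<open>r \<ge> 0\<close> by (simp add: t_def)
    have "0 \<le> - (t\<^sup>2 * (r + 2))" using *[of t] by (simp add: p power2_eq_square algebra_simps)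
    then have "t\<^sup>2 * (r + 2) = 0" using \<open>r \<ge> 0\<close> by (intro antisym) auto
    then have "p = 0" using \<open>r \<ge> 0\<close> by (simp add: p)
    then show ?thesis by (simp add: p_def)
  qed
  then have "Q *v w = m *\<^sub>R w" by (metis eq_iff_diff_eq_0 inner_eq_zero_iff)
  moreover have "w \<noteq> 0" using w by auto
  ultimately have "is_eigenvalue Q m" unfolding is_eigenvalue_def by blast
  then have "\<delta> * (v \<bullet> v) \<le> m * (v \<bullet> v)" by (intro mult_right_mono ev) auto
  with q_ge[of v] show ?thesis by linarith
qed

lemma locally_bounded_on_compact:
  assumes "locally_bounded_on S f" "compact K" "K \<subseteq> S"
  shows "bounded (f ` K)"
proof -
  have "\<exists>e>0. bounded (f ` (S \<inter> ball y e))" if "y \<in> K" for y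
    using assms that unfolding locally_bounded_on_def by blast
  then obtain e where e: "\<And>y. y \<in> K \<Longrightarrow> e y > 0 \<and> bounded (f ` (S \<inter> ball y (e y)))" by metis
  obtain C where C: "C \<subseteq> K" "finite C" "K \<subseteq> (\<Union>y\<in>C. ball y (e y))"
  proof (rule compactE_image[OF assms(2), of K "\<lambda>y. ball y (e y)"])
    show "K \<subseteq> (\<Union>y\<in>K. ball y (e y))"
    proof
      fix y assume "y \<in> K"
      then show "y \<in> (\<Union>y\<in>K. ball y (e y))" using e[of y] by (intro UN_I[of y]) auto
    qed
  qed auto
  have "bounded (\<Union>y\<in>C. f ` (S \<inter> ball y (e y)))" using C e by blast
  moreover have "f ` K \<subseteq> (\<Union>y\<in>C. f ` (S \<inter> ball y (e y)))" using C assms(3) by blast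
  ultimately show ?thesis using bounded_subset by blast
qed

lemma locally_uniformly_elliptic_on_compact:
  assumes "locally_uniformly_elliptic_on S a" "compact K" "K \<subseteq> S"
  obtains \<delta> where "\<delta> > 0" "\<And>y v. y \<in> K \<Longrightarrow> \<delta> * (v \<bullet> v) \<le> v \<bullet> (a y *v v)"
proof -
  have "\<exists>e>0. \<exists>\<delta>>0. \<forall>z\<in>S \<inter> ball y e. \<forall>\<mu>. is_eigenvalue (a z) \<mu> \<longrightarrow> \<delta> \<le> \<mu>" if "y \<in> K" for y
    using assms that unfolding locally_uniformly_elliptic_on_def by blast
  then obtain e \<delta> where e: "\<And>y. y \<in> K \<Longrightarrow> e y > 0 \<and> \<delta> y > 0 \<and>
      (\<forall>z\<in>S \<inter> ball y (e y). \<forall>\<mu>. is_eigenvalue (a z) \<mu> \<longrightarrow> \<delta> y \<le> \<mu>)" by metis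
  obtain C where C: "C \<subseteq> K" "finite C" "K \<subseteq> (\<Union>y\<in>C. ball y (e y))"
  proof (rule compactE_image[OF assms(2), of K "\<lambda>y. ball y (e y)"])
    show "K \<subseteq> (\<Union>y\<in>K. ball y (e y))"
    proof
      fix y assume "y \<in> K"
      then show "y \<in> (\<Union>y\<in>K. ball y (e y))" using e[of y] by (intro UN_I[of y]) auto
    qed
  qed auto
  define d where "d = Min (insert 1 (\<delta> ` C))"
  show thesis
  proof (rule that[of d])
    show "d > 0" unfolding d_def using C e by (subst Min_gr_iff) auto
    fix y :: "real ^ 'a" and v :: "real ^ 'a" assume y: "y \<in> K"
    then obtain x where x: "x \<in> C" "y \<in> ball x (e x)" using C by blast
    have "d \<le> \<delta> x" unfolding d_def using C x by (intro Min_le) auto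
    then show "d * (v \<bullet> v) \<le> v \<bullet> (a y *v v)"
    proof (intro quadratic_form_ge_if_eigenvalues_ge)
      show "transpose (a y) = a y"
        using assms y by (auto simp: locally_uniformly_elliptic_on_def)
      fix \<mu> assume "is_eigenvalue (a y) \<mu>"
      moreover have "y \<in> S \<inter> ball x (e x)" using assms(3) x y by blast
      ultimately have "\<delta> x \<le> \<mu>" using e[of x] x(1) C(1) by blast
      with \<open>d \<le> \<delta> x\<close> show "d \<le> \<mu>" by linarith
    qed
  qed
qed

section \<open>Barriers on Euclidean balls\<close>

lemma bounded_image_mult:
  fixes f g :: "'a \<Rightarrow> real"
  assumes "bounded (f ` K)" "bounded (g ` K)"
  shows "bounded ((\<lambda>y. f y * g y) ` K)"
proof -
  obtain a b where "\<And>y. y \<in> K \<Longrightarrow> \<bar>f y\<bar> \<le> a" "\<And>y. y \<in> K \<Longrightarrow> \<bar>g y\<bar> \<le> b"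
    using assms unfolding bounded_iff by (auto simp: image_iff)
  then have "\<bar>f y * g y\<bar> \<le> a * b" if "y \<in> K" for y
    using that by (simp add: abs_mult mult_mono')
  then show ?thesis unfolding bounded_iff by (auto simp del: mem_cball)
qed

lemma bounded_image_sum:
  fixes f :: "'i \<Rightarrow> 'a \<Rightarrow> real"
  shows "(\<And>i. i \<in> I \<Longrightarrow> bounded (f i ` K)) \<Longrightarrow> bounded ((\<lambda>y. \<Sum>i\<in>I. f i y) ` K)"
proof (induction I rule: infinite_finite_induct)
  case (insert i I)
  then show ?case using bounded_plus_comp[of "f i" K "\<lambda>y. \<Sum>i\<in>I. f i y"] by simp
qed (auto simp: bounded_iff image_iff)

definition elliptic_coeffs ::
  "(real ^ 'n) set \<Rightarrow> (real ^ 'n \<Rightarrow> real ^ 'n ^ 'n) \<Rightarrow> (real ^ 'n \<Rightarrow> real ^ 'n)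
    \<Rightarrow> (real ^ 'n::finite \<Rightarrow> real) \<Rightarrow> bool" where
  "elliptic_coeffs S a b c \<longleftrightarrow>
     (\<forall>i j. locally_bounded_on S (\<lambda>y. a y $ i $ j)) \<and> (\<forall>i. locally_bounded_on S (\<lambda>y. b y $ i)) \<and>
     locally_bounded_on S c \<and> locally_uniformly_elliptic_on S a"

lemma partial_cong_smooth:
  assumes "open S" "smooth_on S F" "\<And>y. y \<in> S \<Longrightarrow> F y = G y" "y \<in> S"
  shows "partial i F y = partial i G y"
  using partial_cong[OF assms(1,4,3)] smooth_on_differentiable[OF assms(2,4)] by simp

lemma diff_op_cong:
  assumes "open S" "smooth_on S F" "\<And>y. y \<in> S \<Longrightarrow> F y = G y" "y \<in> S"
  shows "diff_op a b c F y = diff_op a b c G y"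
proof -
  have p: "partial i F z = partial i G z" if "z \<in> S" for i z
    by (rule partial_cong_smooth[OF assms(1-3) that])
  have "partial i (partial j F) y = partial i (partial j G) y" for i j
    by (rule partial_cong_smooth[OF assms(1) smooth_on_partial[OF assms(2)] p assms(4)])
  then show ?thesis unfolding diff_op_def using p[OF assms(4)] assms(3)[OF assms(4)] by simp
qed

text \<open>
  The outer derivative sees the inner one on a neighbourhood of \<open>y\<close>, which is why smoothness is
  required on an open set.
\<close>

lemma diff_op_linear_comb:
  assumes "open S" "finite I" "\<And>i. i \<in> I \<Longrightarrow> smooth_on S (F i)" "y \<in> S"
  shows "diff_op a b c (\<lambda>y. \<Sum>i\<in>I. t i * F i y) y = (\<Sum>i\<in>I. t i * diff_op a b c (F i) y)"
proof -
  let ?G = "\<lambda>y. \<Sum>i\<in>I. t i * F i y"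
  have p: "partial j ?G z = (\<Sum>i\<in>I. t i * partial j (F i) z)" if "z \<in> S" for j z
    using assms that smooth_on_differentiable by (intro partial_linear_comb) blast+
  have pd: "partial j (F i) differentiable at z" if "z \<in> S" "i \<in> I" for z i j
    using smooth_on_differentiable smooth_on_partial assms(3) that by blast
  have "partial k (partial j ?G) y = partial k (\<lambda>z. \<Sum>i\<in>I. t i * partial j (F i) z) y" for j k
    using p pd assms
    by (intro partial_cong[OF assms(1,4), symmetric]) (auto intro!: differentiable_sum differentiable_mult)
  also have "\<dots> j k = (\<Sum>i\<in>I. t i * partial k (partial j (F i)) y)" for j k
    using pd assms by (intro partial_linear_comb) auto
  finally have pp: "partial k (partial j ?G) y = (\<Sum>i\<in>I. t i * partial k (partial j (F i)) y)" for j k .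
  have swap: "(\<Sum>i\<in>I. t i * (\<Sum>k\<in>UNIV. \<Sum>j\<in>UNIV. a y $ k $ j * partial k (partial j (F i)) y))
      = (\<Sum>k\<in>UNIV. \<Sum>j\<in>UNIV. a y $ k $ j * (\<Sum>i\<in>I. t i * partial k (partial j (F i)) y))"
    unfolding sum_distrib_left
    by (subst sum.swap, intro sum.cong refl, subst sum.swap, intro sum.cong refl) (simp add: mult_ac)
  have swap': "(\<Sum>i\<in>I. t i * (\<Sum>k\<in>UNIV. b y $ k * partial k (F i) y))
      = (\<Sum>k\<in>UNIV. b y $ k * (\<Sum>i\<in>I. t i * partial k (F i) y))"
    unfolding sum_distrib_left by (subst sum.swap, intro sum.cong refl) (simp add: mult_ac)
  have swap'': "(\<Sum>i\<in>I. t i * (c y * F i y)) = c y * (\<Sum>i\<in>I. t i * F i y)"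
    unfolding sum_distrib_left by (intro sum.cong refl) (simp add: mult_ac)
  show ?thesis
    unfolding diff_op_def pp p[OF assms(4)] distrib_left sum.distrib swap swap' swap'' ..
qed

lemma elliptic_coeffs_bounded:
  assumes "elliptic_coeffs S a b c" "compact K" "K \<subseteq> S"
  shows "bounded ((\<lambda>y. a y $ i $ j) ` K)" "bounded ((\<lambda>y. b y $ i) ` K)" "bounded (c ` K)"
  by (rule locally_bounded_on_compact[OF _ assms(2,3)],
      use assms(1) in \<open>simp add: elliptic_coeffs_def\<close>)+

lemma bounded_diff_op:
  assumes "elliptic_coeffs S a b c" "compact K" "K \<subseteq> S" "smooth_on S F"
  shows "bounded (diff_op a b c F ` K)"
proof -
  note b = elliptic_coeffs_bounded[OF assms(1-3)]
  have s: "bounded (F ` K)" if "smooth_on S F" for F :: "real ^ 'a \<Rightarrow> real"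
    by (intro compact_imp_bounded compact_continuous_image assms(2)
        continuous_on_subset[OF smooth_on_continuous[OF that] assms(3)])
  show ?thesis unfolding diff_op_def[abs_def]
    by (intro bounded_plus_comp bounded_image_mult bounded_image_sum b
        s[OF assms(4)] s[OF smooth_on_partial[OF assms(4)]]
        s[OF smooth_on_partial[OF smooth_on_partial[OF assms(4)]]])
qed

text \<open>
  At the centre of the ball the bump has a maximum, and no such estimate can be expected. The
  gradient of \<open>R\<^sup>2 - |y - q|\<^sup>2\<close> is bounded away from zero outside \<open>ball q \<epsilon>\<close>, and there uniform
  ellipticity lets the second order term win. The factor \<open>2\<close> leaves room for the later inequality
  between \<open>A u - u\<close> and \<open>u\<close>.
\<close>

lemma barrier_on_ball:
  fixes q :: "real ^ 'n::finite"
  assumes coeffs: "elliptic_coeffs S a b c" and S: "cball q R \<subseteq> S" and "R > 0" "\<epsilon> > 0"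
  obtains F where "smooth_on UNIV F" "\<And>y. F y \<ge> 0" "\<And>y. F y > 0 \<longleftrightarrow> y \<in> ball q R"
    "\<And>y. y \<in> cball q R \<Longrightarrow> y \<notin> ball q \<epsilon> \<Longrightarrow> 2 * F y \<le> diff_op a b c F y"
proof -
  let ?K = "cball q R"
  note bd = elliptic_coeffs_bounded[OF coeffs compact_cball S]
  have "bounded ((\<lambda>y. (y - q) $ i) ` ?K)" for i
    by (intro compact_imp_bounded compact_continuous_image continuous_intros compact_cball)
  then have "bounded ((\<lambda>y. (\<Sum>i\<in>UNIV. a y $ i $ i) + b y \<bullet> (y - q)) ` ?K)"
    unfolding inner_vec_def inner_real_def
    by (intro bounded_plus_comp bounded_image_mult bounded_image_sum bd)
  then obtain K1 where K1: "\<And>y. y \<in> ?K \<Longrightarrow> \<bar>(\<Sum>i\<in>UNIV. a y $ i $ i) + b y \<bullet> (y - q)\<bar> \<le> K1"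
    unfolding bounded_iff by (auto simp del: mem_cball)
  obtain K2 where K2: "\<And>y. y \<in> ?K \<Longrightarrow> \<bar>c y\<bar> \<le> K2"
    using bd(3) unfolding bounded_iff by (auto simp del: mem_cball)
  obtain \<delta> where \<delta>: "\<delta> > 0" "\<And>y v. y \<in> ?K \<Longrightarrow> \<delta> * (v \<bullet> v) \<le> v \<bullet> (a y *v v)"
    using locally_uniformly_elliptic_on_compact[of S a ?K] coeffs S
    unfolding elliptic_coeffs_def by auto
  obtain \<beta> where \<beta>: "\<beta> > 0"
    "\<And>t e w k. \<lbrakk>t \<le> R\<^sup>2; \<delta> * \<epsilon>\<^sup>2 \<le> e; \<bar>w\<bar> \<le> max 0 (max K1 K2); \<bar>k\<bar> \<le> max 0 (max K1 K2)\<rbrakk> \<Longrightarrow>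
      2 * flat \<beta> 0 t \<le>
        4 * \<beta> * (\<beta> * flat \<beta> 4 t - 2 * flat \<beta> 3 t) * e - 2 * \<beta> * flat \<beta> 2 t * w + k * flat \<beta> 0 t"
    using flat_dominates[of "\<delta> * \<epsilon>\<^sup>2" "R\<^sup>2" "max 0 (max K1 K2)"] \<open>R > 0\<close> \<open>\<epsilon> > 0\<close> \<delta>(1) by auto
  show thesis
  proof (rule that[of "bump \<beta> R q"])
    show "smooth_on UNIV (bump \<beta> R q)" by (rule smooth_on_bump[OF \<beta>(1)])
    fix y :: "real ^ 'n"
    have nn: "(y - q) \<bullet> (y - q) = (dist q y)\<^sup>2" by (metis dist_commute dist_norm power2_norm_eq_inner)
    show "bump \<beta> R q y \<ge> 0" by (simp add: bump_def flat_nonneg)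
    show "bump \<beta> R q y > 0 \<longleftrightarrow> y \<in> ball q R"
      unfolding bump_def flat_pos_iff nn mem_ball
      using \<open>R > 0\<close> power_strict_mono[of "dist q y" R 2] power_less_imp_less_base[of "dist q y" 2 R] by fastforce
    assume y: "y \<in> ?K" "y \<notin> ball q \<epsilon>"
    then have "\<epsilon>\<^sup>2 \<le> (y - q) \<bullet> (y - q)" unfolding nn using \<open>\<epsilon> > 0\<close> by (intro power_mono) auto
    then have "\<delta> * \<epsilon>\<^sup>2 \<le> (y - q) \<bullet> (a y *v (y - q))"
      using \<delta> y(1) by (meson less_imp_le mult_left_mono order_trans)
    then show "2 * bump \<beta> R q y \<le> diff_op a b c (bump \<beta> R q) y"
      unfolding diff_op_bump[OF \<beta>(1)] unfolding bump_def
      using K1[OF y(1)] K2[OF y(1)] by (intro \<beta>(2)) (auto simp: le_max_iff_disj)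
  qed
qed

section \<open>Locality and linearity of elliptic operators on manifolds\<close>

locale elliptic_manifold =
  fixes M :: "'m topology" and \<A> :: "('m, 'n::finite) chart set"
    and A :: "('m \<Rightarrow> real) \<Rightarrow> 'm \<Rightarrow> real"
  assumes manifold: "smooth_manifold M \<A>" and elliptic: "elliptic_operator \<A> A"
begin

lemma Hausdorff: "Hausdorff_space M" and second_countable: "second_countable M"
  and atlas: "smooth_atlas M \<A>"
  using manifold by (auto simp: smooth_manifold_def smooth_structure_def)

lemma chart_exists:
  assumes "p \<in> topspace M"
  obtains U x where "(U, x) \<in> \<A>" "p \<in> U"
  using atlas assms unfolding smooth_atlas_def by blast

context
  fixes U :: "'m set" and x :: "'m \<Rightarrow> real ^ 'n"
  assumes chart: "(U, x) \<in> \<A>"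
begin

lemma chart_domain: "openin M U" and chart_range: "open (x ` U)"
  and chart_homeo: "homeomorphic_map (subtopology M U) (top_of_set (x ` U)) x"
  using atlas chart by (auto simp: smooth_atlas_def is_chart_def)

lemma chart_topspace: "topspace (subtopology M U) = U"
  using openin_subset[OF chart_domain] by auto

lemma chart_inj: "inj_on x U"
  using homeomorphic_imp_injective_map[OF chart_homeo] chart_topspace by simp

lemma inv_chart: "p \<in> U \<Longrightarrow> inv_into U x (x p) = p"
  using chart_inj by simp

lemma chart_preimage_open:
  assumes "open T"
  shows "openin M {p \<in> U. x p \<in> T}"
proof -
  have "openin (subtopology M U) {p \<in> topspace (subtopology M U). x p \<in> x ` U \<inter> T}"
    using homeomorphic_imp_continuous_map[OF chart_homeo] assms
    by (intro openin_continuous_map_preimage[of _ "top_of_set (x ` U)"]) auto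
  moreover have "{p \<in> topspace (subtopology M U). x p \<in> x ` U \<inter> T} = {p \<in> U. x p \<in> T}"
    unfolding chart_topspace by auto
  ultimately show ?thesis using chart_domain openin_trans_full by metis
qed

lemma chart_image_open:
  assumes "openin M N"
  shows "open (x ` (U \<inter> N))"
proof -
  have "openin (subtopology M U) (U \<inter> N)" using assms by (metis openin_subtopology_Int2)
  then have "openin (top_of_set (x ` U)) (x ` (U \<inter> N))"
    using homeomorphic_imp_open_map[OF chart_homeo] unfolding open_map_def by blast
  then show ?thesis using chart_range openin_open_trans by blast
qed

lemma chart_preimage_compact:
  assumes "compact C" "C \<subseteq> x ` U"
  shows "compactin M {p \<in> U. x p \<in> C}"
proof -
  obtain g where g: "homeomorphic_maps (subtopology M U) (top_of_set (x ` U)) x g"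
    using chart_homeo unfolding homeomorphic_map_maps by blast
  then have gx: "g (x p) = p" if "p \<in> U" for p
    using that chart_topspace unfolding homeomorphic_maps_def by auto
  have "continuous_map (top_of_set (x ` U)) (subtopology M U) g"
    using g unfolding homeomorphic_maps_def by blast
  moreover have "compactin (top_of_set (x ` U)) C" using assms by (simp add: compactin_subtopology)
  ultimately have "compactin (subtopology M U) (g ` C)" by (rule image_compactin[rotated])
  moreover have "g ` C = {p \<in> U. x p \<in> C}" using gx assms(2) by force
  ultimately show ?thesis by (simp add: compactin_subtopology)
qed

lemma smooth_fun_in_chart: "smooth_fun \<A> f \<Longrightarrow> smooth_on (x ` U) (f \<circ> inv_into U x)"
  using chart by (auto simp: smooth_fun_def)

lemma operator_in_chart:
  "\<exists>a b c. elliptic_coeffs (x ` U) a b c \<and>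
      (\<forall>f. smooth_fun \<A> f \<longrightarrow> (\<forall>p\<in>U. A f p = diff_op a b c (f \<circ> inv_into U x) (x p)))"
  using elliptic[unfolded elliptic_operator_def, THEN bspec, OF chart]
  unfolding elliptic_coeffs_def diff_op_def Let_def prod.case conj_assoc .

end

lemma smooth_fun_locally:
  assumes "\<And>p. p \<in> topspace M \<Longrightarrow> \<exists>N g. openin M N \<and> p \<in> N \<and> smooth_fun \<A> g \<and> (\<forall>q\<in>N. f q = g q)"
  shows "smooth_fun \<A> f"
  unfolding smooth_fun_def
proof clarify
  fix U x assume ch: "(U, x) \<in> \<A>"
  show "smooth_on (x ` U) (f \<circ> inv_into U x)"
  proof (rule smooth_on_local)
    fix y assume "y \<in> x ` U"
    then obtain p where p: "p \<in> U" "y = x p" by blast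
    then have "p \<in> topspace M" using chart_domain[OF ch] openin_subset by blast
    then obtain N g where N: "openin M N" "p \<in> N" "smooth_fun \<A> g" "\<forall>q\<in>N. f q = g q"
      using assms by blast
    have o: "open (x ` (U \<inter> N))" by (rule chart_image_open[OF ch N(1)])
    have "smooth_on (x ` (U \<inter> N)) (g \<circ> inv_into U x)"
      by (rule smooth_on_subset[OF smooth_fun_in_chart[OF ch N(3)]]) blast
    then have "smooth_on (x ` (U \<inter> N)) (f \<circ> inv_into U x)"
      by (subst smooth_on_cong[OF o, of _ "g \<circ> inv_into U x"]) (use N(4) inv_chart[OF ch] in auto)
    then show "\<exists>T. open T \<and> y \<in> T \<and> smooth_on T (f \<circ> inv_into U x)" using o p N(2) by blast
  qed
qed

lemma smooth_fun_linear_comb: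
  assumes "\<And>i. i \<in> I \<Longrightarrow> smooth_fun \<A> (f i)"
  shows "smooth_fun \<A> (\<lambda>p. \<Sum>i\<in>I. t i * f i p)"
  unfolding smooth_fun_def
proof clarify
  fix U x assume ch: "(U, x) \<in> \<A>"
  have "smooth_on (x ` U) (\<lambda>y. \<Sum>i\<in>I. t i *\<^sub>R (f i \<circ> inv_into U x) y)"
    unfolding smooth_on_def
  proof (intro allI Ck_on_sum Ck_on_scaleR Ck_on_const chart_range[OF ch])
    fix k i assume "i \<in> I"
    then show "Ck_on k (x ` U) (f i \<circ> inv_into U x)"
      using smooth_fun_in_chart[OF ch assms] unfolding smooth_on_def by blast
  qed
  then show "smooth_on (x ` U) ((\<lambda>p. \<Sum>i\<in>I. t i * f i p) \<circ> inv_into U x)"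
    by (simp add: o_def)
qed

text \<open>
  The operator acts in a chart as a differential operator, so it only sees the germ of a function.
  This form of linearity serves infinite sums, which are finite sums only locally.
\<close>

lemma operator_linear_comb_near:
  assumes "finite I" "\<And>i. i \<in> I \<Longrightarrow> smooth_fun \<A> (f i)" "smooth_fun \<A> g"
    and N: "openin M N" "p \<in> N" "\<And>q. q \<in> N \<Longrightarrow> g q = (\<Sum>i\<in>I. t i * f i q)"
  shows "A g p = (\<Sum>i\<in>I. t i * A (f i) p)"
proof -
  obtain U x where ch: "(U, x) \<in> \<A>" "p \<in> U"
    using chart_exists N openin_subset by blast
  obtain a b c where
    abc: "\<forall>f. smooth_fun \<A> f \<longrightarrow> (\<forall>p\<in>U. A f p = diff_op a b c (f \<circ> inv_into U x) (x p))"
    using operator_in_chart[OF ch(1)] by blast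
  have o: "open (x ` (U \<inter> N))" by (rule chart_image_open[OF ch(1) N(1)])
  have p: "x p \<in> x ` (U \<inter> N)" using ch(2) N(2) by blast
  have sm: "smooth_on (x ` (U \<inter> N)) (h \<circ> inv_into U x)" if "smooth_fun \<A> h" for h
    by (rule smooth_on_subset[OF smooth_fun_in_chart[OF ch(1) that]]) blast
  have "A g p = diff_op a b c (g \<circ> inv_into U x) (x p)" using abc assms(3) ch(2) by simp
  also have "\<dots> = diff_op a b c (\<lambda>y. \<Sum>i\<in>I. t i * (f i \<circ> inv_into U x) y) (x p)"
    by (rule diff_op_cong[OF o sm[OF assms(3)] _ p]) (use N(3) inv_chart[OF ch(1)] in auto)
  also have "\<dots> = (\<Sum>i\<in>I. t i * diff_op a b c (f i \<circ> inv_into U x) (x p))"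
    by (rule diff_op_linear_comb[OF o assms(1) sm[OF assms(2)] p])
  also have "\<dots> = (\<Sum>i\<in>I. t i * A (f i) p)" using abc assms(2) ch(2) by simp
  finally show ?thesis .
qed

lemma operator_eq_0_near:
  assumes "smooth_fun \<A> g" "openin M N" "p \<in> N" "\<And>q. q \<in> N \<Longrightarrow> g q = 0"
  shows "A g p = 0"
  using operator_linear_comb_near[of "{}" undefined g N p] assms by simp

text \<open>
  Summing over the indices with nonzero terms gives the pointwise sum without any notion of
  convergence, since under local finiteness there are finitely many of them at each point.
\<close>

definition locally_finite_sum :: "(nat \<Rightarrow> 'm \<Rightarrow> real) \<Rightarrow> 'm \<Rightarrow> real" where
  "locally_finite_sum f p = (\<Sum>i | f i p \<noteq> 0. f i p)"

context
  fixes f :: "nat \<Rightarrow> 'm \<Rightarrow> real"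
  assumes smooth: "\<And>i. smooth_fun \<A> (f i)"
    and locally_finite:
      "\<And>p. p \<in> topspace M \<Longrightarrow> \<exists>N. openin M N \<and> p \<in> N \<and> finite {i. \<exists>q\<in>N. f i q \<noteq> 0}"
begin

lemma locally_finite_sum_near:
  assumes "p \<in> topspace M"
  obtains N n where "openin M N" "p \<in> N"
    "\<And>m q. m \<ge> n \<Longrightarrow> q \<in> N \<Longrightarrow> locally_finite_sum f q = (\<Sum>i<m. f i q)"
proof -
  obtain N where N: "openin M N" "p \<in> N" "finite {i. \<exists>q\<in>N. f i q \<noteq> 0}"
    using locally_finite[OF assms] by blast
  obtain n where n: "{i. \<exists>q\<in>N. f i q \<noteq> 0} \<subseteq> {..<n}"
    using N(3) finite_nat_iff_bounded by blast
  show thesis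
  proof (rule that[OF N(1,2)])
    have z: "f i q = 0" if "i \<ge> n" "q \<in> N" for i q using n that by force
    show "locally_finite_sum f q = (\<Sum>i<m. f i q)" if "m \<ge> n" "q \<in> N" for m q
    proof -
      have "i < m" if "f i q \<noteq> 0" for i
        using z[of i q] that \<open>m \<ge> n\<close> \<open>q \<in> N\<close> by (meson leI order_trans)
      then show ?thesis
        unfolding locally_finite_sum_def by (intro sum.mono_neutral_left) auto
    qed
  qed
qed

lemma smooth_locally_finite_sum: "smooth_fun \<A> (locally_finite_sum f)"
proof (rule smooth_fun_locally)
  fix p assume "p \<in> topspace M"
  then obtain N n where N: "openin M N" "p \<in> N"
    "\<And>m q. m \<ge> n \<Longrightarrow> q \<in> N \<Longrightarrow> locally_finite_sum f q = (\<Sum>i<m. f i q)"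
    using locally_finite_sum_near by metis
  moreover have "smooth_fun \<A> (\<lambda>p. \<Sum>i<n. f i p)"
    using smooth_fun_linear_comb[of "{..<n}" f "\<lambda>_. 1"] smooth by simp
  ultimately show "\<exists>N g. openin M N \<and> p \<in> N \<and> smooth_fun \<A> g \<and> (\<forall>q\<in>N. locally_finite_sum f q = g q)"
    by blast
qed

lemma operator_locally_finite_sum:
  assumes "p \<in> topspace M"
  obtains n where "\<And>m. m \<ge> n \<Longrightarrow> locally_finite_sum f p = (\<Sum>i<m. f i p)"
    "\<And>m. m \<ge> n \<Longrightarrow> A (locally_finite_sum f) p = (\<Sum>i<m. A (f i) p)"
proof -
  obtain N n where N: "openin M N" "p \<in> N"
    "\<And>m q. m \<ge> n \<Longrightarrow> q \<in> N \<Longrightarrow> locally_finite_sum f q = (\<Sum>i<m. f i q)"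
    using locally_finite_sum_near[OF assms] by metis
  show thesis
  proof (rule that)
    show "locally_finite_sum f p = (\<Sum>i<m. f i p)" if "m \<ge> n" for m using N that by blast
    show "A (locally_finite_sum f) p = (\<Sum>i<m. A (f i) p)" if "m \<ge> n" for m
      using operator_linear_comb_near[of "{..<m}" f "locally_finite_sum f" N p "\<lambda>_. 1"]
        smooth smooth_locally_finite_sum N that by simp
  qed
qed

end

end

section \<open>Barrier cells\<close>

context elliptic_manifold begin

text \<open>
  A compact subset of the chart domain is closed in the manifold because the manifold is Hausdorff, so
  its complement is an open set on which the extension vanishes. Together with the chart domain
  it covers the manifold; on the chart domain the change of charts is smooth.
\<close>

lemma smooth_extension_by_zero:
  assumes ch: "(U, x) \<in> \<A>" and F: "smooth_on UNIV F"
    and K: "compact K" "K \<subseteq> x ` U" "\<And>y. y \<notin> K \<Longrightarrow> F y = 0"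
  shows "smooth_fun \<A> (\<lambda>p. if p \<in> U then F (x p) else 0)" (is "smooth_fun \<A> ?v")
  unfolding smooth_fun_def
proof clarify
  fix V y assume ch': "(V, y) \<in> \<A>"
  have K0: "F z \<noteq> 0 \<Longrightarrow> z \<in> K" for z using K(3) by blast
  define C where "C = {p \<in> U. x p \<in> K}"
  have "closedin M C"
    unfolding C_def using chart_preimage_compact[OF ch K(1,2)] Hausdorff by (rule compactin_imp_closedin[rotated])
  then have "openin M (topspace M - C)" by blast
  then have 1: "open (y ` (V \<inter> (topspace M - C)))" by (rule chart_image_open[OF ch'])
  have 2: "open (y ` (V \<inter> U))" by (rule chart_image_open[OF ch' chart_domain[OF ch]])
  show "smooth_on (y ` V) (?v \<circ> inv_into V y)"
  proof (rule smooth_on_local)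
    fix z assume "z \<in> y ` V"
    then obtain p where p: "p \<in> V" "z = y p" by blast
    then have pM: "p \<in> topspace M" using chart_domain[OF ch'] openin_subset by blast
    show "\<exists>T. open T \<and> z \<in> T \<and> smooth_on T (?v \<circ> inv_into V y)"
    proof (cases "p \<in> C")
      case False
      have "smooth_on (y ` (V \<inter> (topspace M - C))) (?v \<circ> inv_into V y)
          \<longleftrightarrow> smooth_on (y ` (V \<inter> (topspace M - C))) (\<lambda>_. 0 :: real)"
        by (rule smooth_on_cong[OF 1]) (use inv_chart[OF ch'] in \<open>auto simp: C_def dest!: K0\<close>)
      then have "smooth_on (y ` (V \<inter> (topspace M - C))) (?v \<circ> inv_into V y)"
        using smooth_on_const[OF 1, of "0::real"] by simp
      then show ?thesis using 1 p pM False by blast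
    next
      case True
      then have pU: "p \<in> U" by (simp add: C_def)
      have "smooth_compatible (V, y) (U, x)" using atlas ch ch' unfolding smooth_atlas_def by blast
      then have "smooth_on (y ` (V \<inter> U)) (x \<circ> inv_into V y)" by (simp add: smooth_compatible_def)
      from smooth_on_compose[OF 2 open_UNIV this F]
      have "smooth_on (y ` (V \<inter> U)) (\<lambda>z. F ((x \<circ> inv_into V y) z))" by blast
      moreover have "smooth_on (y ` (V \<inter> U)) (?v \<circ> inv_into V y)
          \<longleftrightarrow> smooth_on (y ` (V \<inter> U)) (\<lambda>z. F ((x \<circ> inv_into V y) z))"
        by (rule smooth_on_cong[OF 2]) (use inv_chart[OF ch'] in auto)
      ultimately show ?thesis using 2 p pU by blast
    qed
  qed
qed

text \<open>
  The Euclidean barrier of the coordinate ball, transplanted to the manifold. The bad set, where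
  \<open>A v < 2 v\<close> is possible, shrinks into any given neighbourhood \<open>G\<close> of the centre, and there \<open>A v - v\<close> is
  at least bounded below.
\<close>

lemma barrier_in_chart:
  assumes ch: "(U, x) \<in> \<A>" and R: "cball (x q) R \<subseteq> x ` U" "R > 0" and q: "q \<in> U"
    and G: "openin M G" "q \<in> G"
  obtains v C where "smooth_fun \<A> v" "\<And>p. v p \<ge> 0"
    "\<And>p. p \<in> U \<Longrightarrow> x p \<in> ball (x q) R \<Longrightarrow> v p > 0"
    "\<And>p. p \<notin> U \<or> x p \<notin> ball (x q) R \<Longrightarrow> v p = 0"
    "continuous_map (subtopology M U) euclideanreal v"
    "\<And>p. p \<in> topspace M - G \<Longrightarrow> 2 * v p \<le> A v p"
    "\<And>p. p \<in> topspace M \<Longrightarrow> v p - C \<le> A v p" "C \<ge> 0"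
proof -
  obtain a b c where abc: "elliptic_coeffs (x ` U) a b c"
    and op: "\<forall>f. smooth_fun \<A> f \<longrightarrow> (\<forall>p\<in>U. A f p = diff_op a b c (f \<circ> inv_into U x) (x p))"
    using operator_in_chart[OF ch] by blast
  have "open (x ` (U \<inter> G))" "x q \<in> x ` (U \<inter> G)" using chart_image_open[OF ch G(1)] q G(2) by auto
  then obtain \<epsilon> where \<epsilon>: "\<epsilon> > 0" "ball (x q) \<epsilon> \<subseteq> x ` (U \<inter> G)"
    using open_contains_ball by metis
  obtain F where F: "smooth_on UNIV F" "\<And>y. F y \<ge> 0" "\<And>y. F y > 0 \<longleftrightarrow> y \<in> ball (x q) R"
    "\<And>y. y \<in> cball (x q) R \<Longrightarrow> y \<notin> ball (x q) \<epsilon> \<Longrightarrow> 2 * F y \<le> diff_op a b c F y"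
    using barrier_on_ball[OF abc R \<epsilon>(1)] by metis
  let ?K = "cball (x q) R"
  have F0: "F y = 0" if "y \<notin> ball (x q) R" for y using F(2,3)[of y] that by linarith
  define v where "v = (\<lambda>p. if p \<in> U then F (x p) else 0)"
  have smooth: "smooth_fun \<A> v" unfolding v_def
    by (rule smooth_extension_by_zero[OF ch F(1) compact_cball R(1)]) (use F0 in auto)
  have F': "smooth_on (x ` U) F" using F(1) smooth_on_subset by blast
  have Av: "A v p = diff_op a b c F (x p)" if "p \<in> U" for p
  proof -
    have "A v p = diff_op a b c (v \<circ> inv_into U x) (x p)" using op smooth that by blast
    also have "\<dots> = diff_op a b c F (x p)"
      by (rule diff_op_cong[OF chart_range[OF ch], symmetric, OF F'])
        (use that inv_chart[OF ch] in \<open>auto simp: v_def\<close>)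
    finally show ?thesis .
  qed
  have closed: "closedin M {p \<in> U. x p \<in> ?K}"
    using compactin_imp_closedin[OF Hausdorff chart_preimage_compact[OF ch compact_cball R(1)]] .
  have outside: "A v p = 0 \<and> v p = 0" if "p \<in> topspace M" "\<not> (p \<in> U \<and> x p \<in> ?K)" for p
  proof
    have o: "openin M (topspace M - {p \<in> U. x p \<in> ?K})" using closed by blast
    show "A v p = 0"
      by (rule operator_eq_0_near[OF smooth o]) (use that F0 in \<open>auto simp: v_def\<close>)
    show "v p = 0" using that F0 by (auto simp: v_def)
  qed
  have bdd: "bounded (diff_op a b c F ` ?K)" by (rule bounded_diff_op[OF abc compact_cball R(1) F'])
  have "bounded (F ` ?K)"
    by (intro compact_imp_bounded compact_continuous_image compact_cball
        continuous_on_subset[OF smooth_on_continuous[OF F(1)]]) auto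
  then obtain B1 where B1: "\<And>y. y \<in> ?K \<Longrightarrow> \<bar>F y\<bar> \<le> B1"
    unfolding bounded_iff by (auto simp del: mem_cball)
  obtain B2 where B2: "\<And>y. y \<in> ?K \<Longrightarrow> \<bar>diff_op a b c F y\<bar> \<le> B2"
    using bdd unfolding bounded_iff by (auto simp del: mem_cball)
  show thesis
  proof (rule that[OF smooth])
    show "v p \<ge> 0" for p using F(2) by (simp add: v_def)
    show "v p > 0" if "p \<in> U" "x p \<in> ball (x q) R" for p using F(3) that by (simp add: v_def)
    show "v p = 0" if "p \<notin> U \<or> x p \<notin> ball (x q) R" for p using F0 that by (auto simp: v_def)
    have "continuous_map (subtopology M U) (top_of_set (x ` U)) x"
      by (rule homeomorphic_imp_continuous_map[OF chart_homeo[OF ch]])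
    moreover have "continuous_map (top_of_set (x ` U)) euclideanreal F"
      using smooth_on_continuous[OF F'] by simp
    ultimately have "continuous_map (subtopology M U) euclideanreal (F \<circ> x)"
      by (rule continuous_map_compose)
    then show "continuous_map (subtopology M U) euclideanreal v"
      by (rule continuous_map_eq) (use chart_topspace[OF ch] in \<open>auto simp: v_def\<close>)
    show "2 * v p \<le> A v p" if p: "p \<in> topspace M - G" for p
    proof (cases "p \<in> U \<and> x p \<in> ?K")
      case True
      then have "x p \<notin> ball (x q) \<epsilon>"
        using \<epsilon>(2) p chart_inj[OF ch] by (auto dest!: subsetD simp: inj_on_def)
      with True F(4) Av show ?thesis by (simp add: v_def)
    next
      case False
      with outside[of p] p show ?thesis by auto
    qed
    show "v p - max 0 (B1 + B2) \<le> A v p" if p: "p \<in> topspace M" for p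
    proof (cases "p \<in> U \<and> x p \<in> ?K")
      case True
      with B1[of "x p"] B2[of "x p"] Av[of p] show ?thesis by (simp add: v_def)
    next
      case False
      with outside[of p] p show ?thesis by auto
    qed
  qed simp
qed

text \<open>
  The freedom in the choice of \<open>q\<close> matters: for every point \<open>q\<close> of \<open>W\<close> there is a nonnegative
  function supported in \<open>V\<close>, bounded below on all of \<open>W\<close>, whose bad set is a small neighbourhood
  of \<open>q\<close>. The function for one cell can therefore be used to repair the bad set of another
  one, wherever in \<open>W\<close> that set lies.
\<close>

definition has_barriers :: "'m set \<Rightarrow> 'm set \<Rightarrow> bool" where
  "has_barriers W V \<longleftrightarrow>
     (\<forall>q G. q \<in> W \<and> openin M G \<and> q \<in> G \<longrightarrow> (\<exists>v C \<eta>.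
        smooth_fun \<A> v \<and> (\<forall>p. 0 \<le> v p) \<and> (\<forall>p. p \<notin> V \<longrightarrow> v p = 0) \<and>
        \<eta> > 0 \<and> (\<forall>p\<in>W. \<eta> \<le> v p) \<and>
        C \<ge> 0 \<and> (\<forall>p\<in>topspace M. v p - C \<le> A v p) \<and> (\<forall>p\<in>topspace M - G. 2 * v p \<le> A v p)))"

text \<open>
  The condition on singletons, which holds because the dimension is positive, allows one to
  choose a point of an open subset of \<open>W\<close> different from a given one.
\<close>

definition barrier_cell :: "'m set \<Rightarrow> 'm set \<Rightarrow> bool" where
  "barrier_cell W V \<longleftrightarrow>
     openin M W \<and> W \<noteq> {} \<and> W \<subseteq> V \<and> (\<exists>K. compactin M K \<and> V \<subseteq> K) \<and>
     (\<forall>N q. openin M N \<longrightarrow> N \<subseteq> W \<longrightarrow> N \<noteq> {q}) \<and> has_barriers W V"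

text \<open>
  Take a coordinate ball of radius \<open>r\<close> for \<open>W\<close> and the concentric one of radius \<open>3 r\<close> for \<open>V\<close>. For \<open>q \<in> W\<close>
  the ball of radius \<open>2 r\<close> about \<open>q\<close> contains the closed ball of radius \<open>r\<close> and stays inside the large one,
  so the barrier on it is bounded below on \<open>W\<close> and supported in \<open>V\<close>.
\<close>

lemma barrier_cell_exists:
  assumes "openin M N" "p0 \<in> N"
  obtains W V where "barrier_cell W V" "p0 \<in> W" "V \<subseteq> N"
proof -
  obtain U x where ch: "(U, x) \<in> \<A>" "p0 \<in> U" using chart_exists assms openin_subset by blast
  have "open (x ` (U \<inter> N))" "x p0 \<in> x ` (U \<inter> N)" using chart_image_open[OF ch(1) assms(1)] ch assms by auto
  then obtain e where e: "e > 0" "cball (x p0) e \<subseteq> x ` (U \<inter> N)" using open_contains_cball by metis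
  define r where "r = e / 3"
  have r: "r > 0" using e by (simp add: r_def)
  define W where "W = {p \<in> U. x p \<in> ball (x p0) r}"
  define V where "V = {p \<in> U. x p \<in> cball (x p0) (3 * r)}"
  have V: "cball (x p0) (3 * r) \<subseteq> x ` (U \<inter> N)" using e by (simp add: r_def)
  then have VU: "cball (x p0) (3 * r) \<subseteq> x ` U" by blast
  have Wo: "openin M W" unfolding W_def by (rule chart_preimage_open[OF ch(1) open_ball])
  have p0: "p0 \<in> W" using ch r by (simp add: W_def)
  have WV: "W \<subseteq> V" unfolding W_def V_def using r by auto
  have Vc: "compactin M V" unfolding V_def by (rule chart_preimage_compact[OF ch(1) compact_cball VU])
  have WU: "W \<subseteq> U" by (auto simp: W_def)
  define W' where "W' = {p \<in> U. x p \<in> cball (x p0) r}"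
  have "cball (x p0) r \<subseteq> x ` U" using VU r by (meson cball_subset_cball_iff dual_order.trans subset_cball mult_le_cancel_right1 less_imp_le one_le_numeral)
  then have W'c: "compactin M W'" unfolding W'_def by (rule chart_preimage_compact[OF ch(1) compact_cball])
  have single: "N' \<noteq> {q}" if "openin M N'" "N' \<subseteq> W" for N' q
  proof
    assume "N' = {q}"
    then have "open {x q}" using chart_image_open[OF ch(1) that(1)] that(2) WU by (auto simp: Int_absorb1)
    then show False by (simp add: not_open_singleton)
  qed
  have barrier: "\<exists>v C \<eta>. smooth_fun \<A> v \<and> (\<forall>p. 0 \<le> v p) \<and> (\<forall>p. p \<notin> V \<longrightarrow> v p = 0) \<and>
        \<eta> > 0 \<and> (\<forall>p\<in>W. \<eta> \<le> v p) \<and>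
        C \<ge> 0 \<and> (\<forall>p\<in>topspace M. v p - C \<le> A v p) \<and> (\<forall>p\<in>topspace M - G. 2 * v p \<le> A v p)"
    if q: "q \<in> W" and G: "openin M G" "q \<in> G" for q G
  proof -
    have qr: "dist (x p0) (x q) < r" "q \<in> U" using q by (auto simp: W_def)
    have sub: "cball (x q) (2 * r) \<subseteq> cball (x p0) (3 * r)"
      using qr by (auto intro: order_trans[OF dist_triangle])
        (smt (verit) dist_triangle)
    obtain v C where v: "smooth_fun \<A> v" "\<And>p. v p \<ge> 0"
      "\<And>p. p \<in> U \<Longrightarrow> x p \<in> ball (x q) (2 * r) \<Longrightarrow> v p > 0"
      "\<And>p. p \<notin> U \<or> x p \<notin> ball (x q) (2 * r) \<Longrightarrow> v p = 0"
      "continuous_map (subtopology M U) euclideanreal v"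
      "\<And>p. p \<in> topspace M - G \<Longrightarrow> 2 * v p \<le> A v p"
      "\<And>p. p \<in> topspace M \<Longrightarrow> v p - C \<le> A v p" "C \<ge> 0"
      by (rule barrier_in_chart[OF ch(1) order_trans[OF sub VU] _ qr(2) G]) (use r in auto)
    have "compactin (subtopology M U) W'" using W'c by (auto simp: compactin_subtopology W'_def)
    then have "compactin euclideanreal (v ` W')" by (rule image_compactin[OF _ v(5)])
    then have "compact (v ` W')" by simp
    moreover have "v ` W' \<noteq> {}" using p0 by (auto simp: W'_def W_def)
    ultimately obtain s where s: "s \<in> v ` W'" "\<And>t. t \<in> v ` W' \<Longrightarrow> s \<le> t"
      using compact_attains_inf by metis
    then obtain p where p: "p \<in> W'" "s = v p" by blast
    have "x p \<in> ball (x q) (2 * r)"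
      using p(1) qr dist_triangle[of "x q" "x p" "x p0"] by (auto simp: W'_def dist_commute)
    then have "s > 0" using v(3) p by (auto simp: W'_def)
    moreover have "s \<le> v p" if "p \<in> W" for p using s(2) that by (auto simp: W_def W'_def)
    moreover have "v p = 0" if "p \<notin> V" for p
    proof (rule v(4))
      have "p \<notin> U \<or> x p \<notin> cball (x q) (2 * r)" using that sub unfolding V_def by blast
      then show "p \<notin> U \<or> x p \<notin> ball (x q) (2 * r)" by auto
    qed
    ultimately show ?thesis using v by blast
  qed
  have "V \<subseteq> N"
  proof
    fix p assume "p \<in> V"
    then obtain p' where "p' \<in> U \<inter> N" "x p = x p'" "p \<in> U" using V unfolding V_def by blast
    then show "p \<in> N" using chart_inj[OF ch(1)] by (auto dest: inj_onD)
  qed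
  moreover have "has_barriers W V" unfolding has_barriers_def
    by (intro allI impI, elim conjE) (rule barrier)
  then have "barrier_cell W V"
    unfolding barrier_cell_def using Wo p0 WV Vc single by blast
  ultimately show thesis using that p0 by blast
qed

end

section \<open>Compact exhaustions and locally finite covers\<close>

text \<open>
  Every compact set lies in the interior of a larger one. Enlarging repeatedly, and absorbing the
  \<open>i\<close>-th member of a countable cover by relatively compact sets at step \<open>i\<close>, exhausts the space.
\<close>

lemma compact_exhaustion:
  assumes "Lindelof_space X"
    and loc: "\<And>p. p \<in> topspace X \<Longrightarrow> \<exists>U K. openin X U \<and> compactin X K \<and> p \<in> U \<and> U \<subseteq> K"
  shows "\<exists>K :: nat \<Rightarrow> 'a set. K 0 = {} \<and> (\<forall>i. compactin X (K i)) \<and>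
    (\<forall>i. K i \<subseteq> X interior_of K (Suc i)) \<and> (\<Union>i. K i) = topspace X"
proof -
  define \<O> where "\<O> = {U. openin X U \<and> (\<exists>K. compactin X K \<and> U \<subseteq> K)}"
  have cover: "topspace X \<subseteq> \<Union>\<O>" using loc unfolding \<O>_def by blast
  have "\<exists>C'. compactin X C' \<and> C \<subseteq> X interior_of C'" if C: "compactin X C" for C
  proof -
    obtain \<F> where \<F>: "finite \<F>" "\<F> \<subseteq> \<O>" "C \<subseteq> \<Union>\<F>"
      using C cover unfolding compactin_def \<O>_def by (metis (no_types, lifting) mem_Collect_eq order_trans)
    then have "\<forall>U\<in>\<F>. \<exists>K. compactin X K \<and> U \<subseteq> K" "\<forall>U\<in>\<F>. openin X U" unfolding \<O>_def by blast+
    then obtain k where k: "\<And>U. U \<in> \<F> \<Longrightarrow> compactin X (k U) \<and> U \<subseteq> k U" and o: "\<forall>U\<in>\<F>. openin X U"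
      by metis
    have "compactin X (\<Union>(k ` \<F>))" using \<F>(1) k by (intro compactin_Union) auto
    moreover have "\<Union>\<F> \<subseteq> X interior_of \<Union>(k ` \<F>)"
      using k o by (intro interior_of_maximal) (blast, auto)
    ultimately show ?thesis using \<F>(3) by blast
  qed
  then obtain nxt where nxt: "\<And>C. compactin X C \<Longrightarrow> compactin X (nxt C) \<and> C \<subseteq> X interior_of (nxt C)"
    by metis
  have "\<exists>\<V>. countable \<V> \<and> \<V> \<subseteq> \<O> \<and> topspace X \<subseteq> \<Union>\<V>"
  proof -
    have "\<And>U. U \<in> \<O> \<Longrightarrow> openin X U" "\<Union>\<O> = topspace X"
      using cover openin_subset unfolding \<O>_def by blast+
    then show ?thesis using assms(1) unfolding Lindelof_space_def by (metis order_refl)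
  qed
  then obtain \<V> where \<V>: "countable \<V>" "\<V> \<subseteq> \<O>" "topspace X \<subseteq> \<Union>\<V>" by blast
  \<comment> \<open>Inserting the empty set makes the enumeration total also when the cover is empty.\<close>
  define D where "D n = (SOME K. compactin X K \<and> from_nat_into (insert {} \<V>) n \<subseteq> K)" for n
  have "\<exists>K. compactin X K \<and> from_nat_into (insert {} \<V>) n \<subseteq> K" for n
  proof -
    have "from_nat_into (insert {} \<V>) n \<in> insert {} \<V>" by (rule from_nat_into) simp
    then show ?thesis using \<V>(2) compactin_empty[of X] unfolding \<O>_def by blast
  qed
  then have "compactin X (D n) \<and> from_nat_into (insert {} \<V>) n \<subseteq> D n" for n
    unfolding D_def by (rule someI_ex)
  then have D: "compactin X (D n)" "from_nat_into (insert {} \<V>) n \<subseteq> D n" for n by blast+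
  define K where "K = rec_nat {} (\<lambda>i C. nxt (C \<union> D i))"
  have K0: "K 0 = {}" and KS: "K (Suc i) = nxt (K i \<union> D i)" for i by (simp_all add: K_def)
  have Kc: "compactin X (K i)" for i
    by (induction i) (auto simp: K0 KS nxt compactin_Un D)
  show ?thesis
  proof (intro exI[of _ K] conjI allI K0 Kc)
    have sub: "K i \<union> D i \<subseteq> X interior_of K (Suc i)" for i
      unfolding KS using nxt compactin_Un Kc D by blast
    show "K i \<subseteq> X interior_of K (Suc i)" for i using sub by blast
    have DK: "D i \<subseteq> K (Suc i)" for i
      using sub[of i] interior_of_subset[of X "K (Suc i)"] by blast
    have cov: "topspace X \<subseteq> (\<Union>n. D n)"
    proof
      fix p assume "p \<in> topspace X"
      then obtain V where V: "V \<in> \<V>" "p \<in> V" using \<V>(3) by blast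
      then obtain n where "from_nat_into (insert {} \<V>) n = V"
        using from_nat_into_surj[of "insert {} \<V>" V] \<V>(1) by auto
      then show "p \<in> (\<Union>n. D n)" using D(2)[of n] V by blast
    qed
    show "(\<Union>i. K i) = topspace X"
    proof (rule antisym)
      show "(\<Union>i. K i) \<subseteq> topspace X" by (rule UN_least) (rule compactin_subset_topspace[OF Kc])
      show "topspace X \<subseteq> (\<Union>i. K i)"
      proof
        fix p assume "p \<in> topspace X"
        then obtain n where "p \<in> D n" using cov by blast
        then have "p \<in> K (Suc n)" using DK[of n] by blast
        then show "p \<in> (\<Union>i. K i)" by (rule UN_I[OF UNIV_I])
      qed
    qed
  qed
qed

text \<open>
  Each compact layer between two consecutive members of an exhaustion is covered by finitely many cells that
  stay inside a slightly thicker open layer. A point then meets only cells from finitely many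
  layers. Noncompactness makes the family infinite, so that it can be enumerated bijectively by the natural
  numbers.
\<close>

lemma locally_finite_cell_cover:
  fixes X :: "'a topology" and cell :: "'a set \<Rightarrow> 'a set \<Rightarrow> bool"
  assumes "second_countable X" "Hausdorff_space X" "\<not> compact_space X"
    and cell: "\<And>W V. cell W V \<Longrightarrow> openin X W \<and> W \<subseteq> V \<and> (\<exists>K. compactin X K \<and> V \<subseteq> K)"
    and small: "\<And>N p. openin X N \<Longrightarrow> p \<in> N \<Longrightarrow> \<exists>W V. cell W V \<and> p \<in> W \<and> V \<subseteq> N"
  obtains W V :: "nat \<Rightarrow> 'a set" where "\<And>n. cell (W n) (V n)" "(\<Union>n. W n) = topspace X"
    "\<And>p. p \<in> topspace X \<Longrightarrow> \<exists>N. openin X N \<and> p \<in> N \<and> finite {n. N \<inter> V n \<noteq> {}}"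
proof -
  have loc: "\<exists>U K. openin X U \<and> compactin X K \<and> p \<in> U \<and> U \<subseteq> K" if "p \<in> topspace X" for p
    using small[OF openin_topspace that] cell by (meson order_trans)
  obtain K :: "nat \<Rightarrow> 'a set" where "K 0 = {} \<and> (\<forall>i. compactin X (K i)) \<and>
      (\<forall>i. K i \<subseteq> X interior_of K (Suc i)) \<and> (\<Union>i. K i) = topspace X"
    by (rule exE[OF compact_exhaustion[OF second_countable_imp_Lindelof_space[OF assms(1)] loc]])
  then have K: "K 0 = {}" "compactin X (K i)" "K i \<subseteq> X interior_of K (Suc i)"
    "(\<Union>i. K i) = topspace X" for i by simp_all
  have "K i \<subseteq> K (Suc i)" for i using K(3)[of i] interior_of_subset[of X "K (Suc i)"] by blast
  then have mono: "i \<le> j \<Longrightarrow> K i \<subseteq> K j" for i j by (rule lift_Suc_mono_le)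
  have Kclosed: "closedin X (K i)" for i using K(2) assms(2) compactin_imp_closedin by blast
  define S where "S i = K (Suc i) - X interior_of K i" for i
  \<comment> \<open>For \<open>i = 0\<close> nothing is removed, as \<open>K 0\<close> is empty.\<close>
  define Oo where "Oo i = X interior_of K (Suc (Suc i)) - K (i - 1)" for i
  have S: "compactin X (S i)" for i
  proof -
    have "S i = K (Suc i) \<inter> (topspace X - X interior_of K i)"
      using compactin_subset_topspace[OF K(2)] unfolding S_def by blast
    then show ?thesis
      using compact_Int_closedin[OF K(2) closedin_diff[OF closedin_topspace openin_interior_of]] by metis
  qed
  have Oo: "openin X (Oo i)" for i unfolding Oo_def by (rule openin_diff[OF openin_interior_of Kclosed])
  have SO: "S i \<subseteq> Oo i" for i
  proof -
    have "K (i - 1) \<subseteq> X interior_of K i" using K(1,3) by (cases i) auto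
    then show ?thesis using K(3) unfolding S_def Oo_def by blast
  qed
  have "\<forall>i. \<exists>\<Gamma>. finite \<Gamma> \<and> (\<forall>c\<in>\<Gamma>. cell (fst c) (snd c) \<and> snd c \<subseteq> Oo i) \<and> S i \<subseteq> (\<Union>c\<in>\<Gamma>. fst c)"
  proof
    fix i
    have "\<forall>p\<in>S i. \<exists>c. cell (fst c) (snd c) \<and> p \<in> fst c \<and> snd c \<subseteq> Oo i"
      using small[OF Oo] SO by fastforce
    then obtain c where c: "\<And>p. p \<in> S i \<Longrightarrow> cell (fst (c p)) (snd (c p)) \<and> p \<in> fst (c p) \<and> snd (c p) \<subseteq> Oo i"
      by metis
    have "\<forall>U\<in>(\<lambda>p. fst (c p)) ` S i. openin X U" using c cell by blast
    moreover have "S i \<subseteq> \<Union>((\<lambda>p. fst (c p)) ` S i)" using c by blast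
    ultimately obtain \<F> where \<F>: "finite \<F>" "\<F> \<subseteq> (\<lambda>p. fst (c p)) ` S i" "S i \<subseteq> \<Union>\<F>"
      using S[of i] unfolding compactin_def by metis
    then obtain P where P: "finite P" "P \<subseteq> S i" "\<F> = (\<lambda>p. fst (c p)) ` P"
      by (meson finite_subset_image)
    show "\<exists>\<Gamma>. finite \<Gamma> \<and> (\<forall>c\<in>\<Gamma>. cell (fst c) (snd c) \<and> snd c \<subseteq> Oo i) \<and> S i \<subseteq> (\<Union>c\<in>\<Gamma>. fst c)"
    proof (intro exI[of _ "c ` P"] conjI ballI)
      show "finite (c ` P)" using P(1) by blast
      show "cell (fst d) (snd d)" "snd d \<subseteq> Oo i" if "d \<in> c ` P" for d using that P(2) c by blast+
      show "S i \<subseteq> (\<Union>d\<in>c ` P. fst d)" using \<F>(3) P(3) by auto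
    qed
  qed
  from choice[OF this] obtain \<Gamma> where \<Gamma>0: "\<forall>i. finite (\<Gamma> i) \<and>
      (\<forall>c\<in>\<Gamma> i. cell (fst c) (snd c) \<and> snd c \<subseteq> Oo i) \<and> S i \<subseteq> (\<Union>c\<in>\<Gamma> i. fst c)" by (rule exE)
  have \<Gamma>: "finite (\<Gamma> i)" "\<And>c. c \<in> \<Gamma> i \<Longrightarrow> cell (fst c) (snd c) \<and> snd c \<subseteq> Oo i"
    "S i \<subseteq> (\<Union>c\<in>\<Gamma> i. fst c)" for i
    using \<Gamma>0[rule_format, of i] by auto
  define \<Delta> where "\<Delta> = (\<Union>i. \<Gamma> i)"
  have \<Delta>cell: "cell (fst c) (snd c)" if "c \<in> \<Delta>" for c
    using that \<Gamma>(2) unfolding \<Delta>_def by blast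
  have cov: "(\<Union>c\<in>\<Delta>. fst c) = topspace X"
  proof
    show "(\<Union>c\<in>\<Delta>. fst c) \<subseteq> topspace X" using \<Delta>cell cell openin_subset by blast
    show "topspace X \<subseteq> (\<Union>c\<in>\<Delta>. fst c)"
    proof
      fix p assume "p \<in> topspace X"
      then have "\<exists>i. p \<in> K i" using K(4) by blast
      then have "p \<in> K (LEAST i. p \<in> K i)" by (rule LeastI_ex)
      moreover obtain j where j: "(LEAST i. p \<in> K i) = Suc j"
        using K(1) calculation by (metis empty_iff not0_implies_Suc)
      moreover have "p \<notin> K j" using j not_less_Least[of j "\<lambda>i. p \<in> K i"] by simp
      ultimately have "p \<in> S j" unfolding S_def using interior_of_subset[of X "K j"] by auto
      then show "p \<in> (\<Union>c\<in>\<Delta>. fst c)" using \<Gamma>(3)[of j] unfolding \<Delta>_def by fastforce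
    qed
  qed
  have inf: "infinite \<Delta>"
  proof
    assume fin: "finite \<Delta>"
    have "\<exists>C. compactin X C \<and> fst c \<subseteq> C" if "c \<in> \<Delta>" for c
      using \<Delta>cell[OF that] cell by (meson order_trans)
    then obtain C where C: "\<And>c. c \<in> \<Delta> \<Longrightarrow> compactin X (C c) \<and> fst c \<subseteq> C c" by metis
    have c: "compactin X (\<Union>(C ` \<Delta>))" using fin C by (intro compactin_Union) auto
    have "topspace X \<subseteq> \<Union>(C ` \<Delta>)" unfolding cov[symmetric] by (rule UN_mono) (use C in auto)
    with compactin_subset_topspace[OF c] have "\<Union>(C ` \<Delta>) = topspace X" by (rule antisym)
    with c show False using assms(3) by (simp add: compact_space_def)
  qed
  have "countable \<Delta>" unfolding \<Delta>_def using \<Gamma>(1) by (intro countable_UN) (auto intro: countable_finite)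
  then have bij: "bij_betw (from_nat_into \<Delta>) UNIV \<Delta>" using inf by (rule bij_betw_from_nat_into)
  let ?e = "from_nat_into \<Delta>"
  show thesis
  proof (rule that[of "\<lambda>n. fst (?e n)" "\<lambda>n. snd (?e n)"])
    have e: "?e n \<in> \<Delta>" for n using bij bij_betwE by blast
    show "cell (fst (?e n)) (snd (?e n))" for n using \<Delta>cell e by blast
    have "(\<Union>n. fst (?e n)) = (\<Union>c\<in>range ?e. fst c)" by blast
    also have "\<dots> = topspace X" unfolding bij_betw_imp_surj_on[OF bij] by (rule cov)
    finally show "(\<Union>n. fst (?e n)) = topspace X" .
    fix p assume "p \<in> topspace X"
    then obtain j where "p \<in> K j" using K(4) by blast
    then have p: "p \<in> X interior_of K (Suc j)" using K(3) by blast
    have "{n. X interior_of K (Suc j) \<inter> snd (?e n) \<noteq> {}} \<subseteq> ?e -` (\<Union>i\<le>Suc j. \<Gamma> i)"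
    proof
      fix n assume "n \<in> {n. X interior_of K (Suc j) \<inter> snd (?e n) \<noteq> {}}"
      then have ne: "K (Suc j) \<inter> snd (?e n) \<noteq> {}" using interior_of_subset[of X "K (Suc j)"] by blast
      obtain i where i: "?e n \<in> \<Gamma> i" using e unfolding \<Delta>_def by blast
      then have "snd (?e n) \<subseteq> Oo i" using \<Gamma>(2) by blast
      then have "\<not> K (Suc j) \<subseteq> K (i - 1)" using ne unfolding Oo_def by blast
      then have "i \<le> Suc j" using mono[of "Suc j" "i - 1"] by linarith
      then show "n \<in> ?e -` (\<Union>i\<le>Suc j. \<Gamma> i)" using i by blast
    qed
    moreover have "finite (?e -` (\<Union>i\<le>Suc j. \<Gamma> i))"
      using \<Gamma>(1) bij by (intro finite_vimageI) (auto simp: bij_betw_def)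
    ultimately have "finite {n. X interior_of K (Suc j) \<inter> snd (?e n) \<noteq> {}}" by (rule finite_subset)
    with p show "\<exists>N. openin X N \<and> p \<in> N \<and> finite {n. N \<inter> snd (?e n) \<noteq> {}}"
      using openin_interior_of by blast
  qed
qed

section \<open>Locally finite families of rays in graphs\<close>

text \<open>
  All natural numbers are vertices, so the graph is infinite. Connectedness says that no proper nonempty set
  of vertices is closed under adjacency.
\<close>

locale connected_locally_finite_graph =
  fixes adj :: "nat \<Rightarrow> nat \<Rightarrow> bool"
  assumes sym: "adj m n \<Longrightarrow> adj n m"
    and finite_neighbours: "finite {m. adj n m}"
    and connected: "\<lbrakk>S \<noteq> {}; \<And>m n. m \<in> S \<Longrightarrow> adj m n \<Longrightarrow> n \<in> S\<rbrakk> \<Longrightarrow> S = UNIV"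
begin

text \<open>
  Requiring both endpoints of a step to avoid \<open>F\<close> keeps the relation symmetric.
\<close>

definition reach :: "nat set \<Rightarrow> nat \<Rightarrow> nat set" where
  "reach F n = {m. (\<lambda>a b. adj a b \<and> a \<notin> F \<and> b \<notin> F)\<^sup>*\<^sup>* n m}"

definition escapes :: "nat set \<Rightarrow> nat \<Rightarrow> bool" where
  "escapes F n \<longleftrightarrow> n \<notin> F \<and> infinite (reach F n)"

lemma reach_refl: "n \<in> reach F n"
  by (simp add: reach_def)

lemma reach_step: "m \<in> reach F n \<Longrightarrow> adj m k \<Longrightarrow> m \<notin> F \<Longrightarrow> k \<notin> F \<Longrightarrow> k \<in> reach F n"
  unfolding reach_def by (auto intro: rtranclp.rtrancl_into_rtrancl)

lemma reach_induct [consumes 1, case_names refl step]: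
  assumes "m \<in> reach F n" "P n"
    "\<And>m k. m \<in> reach F n \<Longrightarrow> P m \<Longrightarrow> adj m k \<Longrightarrow> m \<notin> F \<Longrightarrow> k \<notin> F \<Longrightarrow> P k"
  shows "P m"
  using assms(1) unfolding reach_def mem_Collect_eq
  by (induction rule: rtranclp_induct) (use assms(2,3) in \<open>auto simp: reach_def\<close>)

lemma reach_avoids: "m \<in> reach F n \<Longrightarrow> n \<notin> F \<Longrightarrow> m \<notin> F"
  by (induction rule: reach_induct) auto

lemma reach_sym: "m \<in> reach F n \<Longrightarrow> n \<in> reach F m"
proof -
  let ?R = "\<lambda>a b. adj a b \<and> a \<notin> F \<and> b \<notin> F"
  have "symp ?R" using sym by (auto simp: symp_def)
  then show "m \<in> reach F n \<Longrightarrow> n \<in> reach F m"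
    unfolding reach_def using sympD[OF symp_rtranclp] by fastforce
qed

lemma reach_trans: "k \<in> reach F m \<Longrightarrow> m \<in> reach F n \<Longrightarrow> k \<in> reach F n"
  unfolding reach_def by auto

text \<open>
  A vertex has finitely many neighbours, so if infinitely many vertices can be reached from \<open>n\<close>,
  then infinitely many can be reached through one of them without returning to \<open>n\<close>. Iterating this
  is Koenig's lemma.
\<close>

lemma escapes_step:
  assumes "escapes F n"
  obtains m where "adj n m" "escapes (insert n F) m"
proof -
  let ?G = "insert n F" and ?N = "{m. adj n m \<and> m \<notin> insert n F}"
  have "t = n \<or> (\<exists>m\<in>?N. t \<in> reach ?G m)" if "t \<in> reach F n" for t
    using that
  proof (induction rule: reach_induct)
    case (step t k)
    show ?case
    proof (cases "k = n")
      case False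
      then have k: "k \<notin> ?G" using step by simp
      show ?thesis
      proof (cases "t = n")
        case True
        then show ?thesis using k step reach_refl by blast
      next
        case False
        then obtain m where "m \<in> ?N" "t \<in> reach ?G m" using step by blast
        moreover have "t \<notin> ?G" using False step by simp
        ultimately show ?thesis using k step reach_step by blast
      qed
    qed simp
  qed simp
  then have "reach F n \<subseteq> insert n (\<Union>m\<in>?N. reach ?G m)" by blast
  moreover have "infinite (reach F n)" using assms by (simp add: escapes_def)
  ultimately have "infinite (\<Union>m\<in>?N. reach ?G m)" using finite_subset by blast
  moreover have "finite ?N" by (rule finite_subset[OF _ finite_neighbours[of n]]) auto
  ultimately obtain m where "m \<in> ?N" "infinite (reach ?G m)" by blast
  then show thesis using that unfolding escapes_def by blast
qed

text \<open>
  By connectedness each finite component of the complement of \<open>F\<close> contains a neighbour of \<open>F\<close>. Since \<open>F\<close> has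
  finitely many neighbours, there are finitely many finite components.
\<close>

lemma finite_not_escapes:
  assumes "finite F"
  shows "finite {n. \<not> escapes F n}"
proof -
  define B where "B = {n. n \<notin> F \<and> finite (reach F n)}"
  define N where "N = (\<Union>f\<in>F. {m. adj f m}) \<inter> B"
  have "\<exists>m\<in>N. n \<in> reach F m" if n: "n \<in> B" for n
  proof -
    have "\<exists>m\<in>reach F n. \<exists>f\<in>F. adj m f"
    proof (rule ccontr)
      assume no: "\<not> ?thesis"
      have "reach F n = UNIV"
      proof (rule connected)
        show "reach F n \<noteq> {}" using reach_refl by blast
        fix m k assume "m \<in> reach F n" "adj m k"
        then show "k \<in> reach F n"
          using no reach_step reach_avoids n unfolding B_def by blast
      qed
      then show False using n unfolding B_def by simp
    qed
    then obtain m f where m: "m \<in> reach F n" "f \<in> F" "adj m f" by blast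
    have "reach F m \<subseteq> reach F n" using m(1) reach_trans by blast
    then have "m \<in> B" using n m reach_avoids finite_subset unfolding B_def by blast
    then have "m \<in> N" unfolding N_def using m sym by blast
    then show ?thesis using m(1) reach_sym by blast
  qed
  then have "B \<subseteq> (\<Union>m\<in>N. reach F m)" by blast
  moreover have "finite N" unfolding N_def using assms finite_neighbours by blast
  then have "finite (\<Union>m\<in>N. reach F m)" unfolding N_def B_def by blast
  ultimately have "finite (F \<union> B)" using assms finite_subset by blast
  moreover have "{n. \<not> escapes F n} \<subseteq> F \<union> B" unfolding escapes_def B_def by blast
  ultimately show ?thesis using finite_subset by blast
qed

lemma ray_exists:
  assumes "escapes F n"
  obtains s :: "nat \<Rightarrow> nat" where "s 0 = n" "\<And>m. adj (s m) (s (Suc m))" "\<And>m. s m \<notin> F" "inj s"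
proof -
  \<comment> \<open>The state is the set of forbidden vertices together with the current vertex; each visited vertex becomes
    forbidden, which makes the ray injective.\<close>
  have "\<exists>c :: nat \<Rightarrow> nat set \<times> nat. \<forall>m. (escapes (fst (c m)) (snd (c m)) \<and> (m = 0 \<longrightarrow> c m = (F, n))) \<and>
      (adj (snd (c m)) (snd (c (Suc m))) \<and> fst (c (Suc m)) = insert (snd (c m)) (fst (c m)))"
  proof (rule dependent_nat_choice)
    show "\<exists>x. escapes (fst x) (snd x) \<and> (0 = (0 :: nat) \<longrightarrow> x = (F, n))" using assms by auto
    fix x :: "nat set \<times> nat" and m :: nat
    assume "escapes (fst x) (snd x) \<and> (m = 0 \<longrightarrow> x = (F, n))"
    then obtain k where "adj (snd x) k" "escapes (insert (snd x) (fst x)) k" using escapes_step by blast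
    then show "\<exists>y. (escapes (fst y) (snd y) \<and> (Suc m = 0 \<longrightarrow> y = (F, n))) \<and>
        adj (snd x) (snd y) \<and> fst y = insert (snd x) (fst x)"
      by (intro exI[of _ "(insert (snd x) (fst x), k)"]) simp
  qed
  then obtain c :: "nat \<Rightarrow> nat set \<times> nat" where c: "\<And>m. escapes (fst (c m)) (snd (c m))" "c 0 = (F, n)"
    "\<And>m. adj (snd (c m)) (snd (c (Suc m)))" "\<And>m. fst (c (Suc m)) = insert (snd (c m)) (fst (c m))"
    by blast
  have "fst (c m) \<subseteq> fst (c (Suc m))" for m using c(4) by blast
  then have mono: "m \<le> k \<Longrightarrow> fst (c m) \<subseteq> fst (c k)" for m k by (rule lift_Suc_mono_le)
  have avoid: "snd (c m) \<notin> fst (c m)" for m using c(1) by (simp add: escapes_def)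
  show thesis
  proof (rule that[of "\<lambda>m. snd (c m)"])
    show "snd (c 0) = n" using c(2) by simp
    show "adj (snd (c m)) (snd (c (Suc m)))" for m by (rule c(3))
    show "snd (c m) \<notin> F" for m using mono[of 0 m] avoid[of m] c(2) by auto
    have "snd (c m) \<noteq> snd (c k)" if "m < k" for m k
      using mono[of "Suc m" k] avoid[of k] c(4)[of m] that by auto
    then show "inj (\<lambda>m. snd (c m))" by (metis injI linorder_neqE_nat)
  qed
qed

text \<open>
  From \<open>k\<close> follow a ray to infinity that avoids the longest initial segment \<open>{..<i}\<close>, \<open>i \<le> k\<close>, which it can
  avoid. All but finitely many vertices can escape from \<open>{..<Suc j}\<close>, hence all but finitely many of
  these rays avoid \<open>j\<close>. A single ray would not do: in a graph with many ends a path from a remote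
  vertex to a fixed end may be forced through the centre.
\<close>

lemma locally_finite_rays:
  "\<exists>r :: nat \<Rightarrow> nat \<Rightarrow> nat. (\<forall>k. r k 0 = k) \<and> (\<forall>k m. adj (r k m) (r k (Suc m))) \<and>
    (\<forall>k. inj (r k)) \<and> (\<forall>j. finite {k. j \<in> range (r k)})"
proof -
  define I where "I k = {i. i \<le> k \<and> escapes {..<i} k}" for k
  have I: "finite (I k)" for k unfolding I_def by simp
  have "escapes {..<0} k" for k
  proof -
    have "reach {} k = UNIV"
      by (rule connected) (use reach_refl reach_step in blast)+
    then show ?thesis by (simp add: escapes_def)
  qed
  then have "I k \<noteq> {}" for k unfolding I_def by blast
  then have M: "Max (I k) \<in> I k" for k using I Max_in by blast
  have "\<exists>s :: nat \<Rightarrow> nat. s 0 = k \<and> (\<forall>m. adj (s m) (s (Suc m))) \<and> (\<forall>m. s m \<notin> {..<Max (I k)}) \<and> inj s" for k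
    using ray_exists[of "{..<Max (I k)}" k] M[of k] unfolding I_def by blast
  then obtain r where r: "\<And>k. r k 0 = k" "\<And>k m. adj (r k m) (r k (Suc m))"
    "\<And>k m. r k m \<notin> {..<Max (I k)}" "\<And>k. inj (r k)" by metis
  show ?thesis
  proof (intro exI[of _ r] conjI allI r(1,2,4))
    fix j
    have "{k. j \<in> range (r k)} \<subseteq> {k. \<not> escapes {..<Suc j} k}"
    proof (rule subsetI, rule CollectI, rule notI)
      fix k assume e: "escapes {..<Suc j} k" and "k \<in> {k. j \<in> range (r k)}"
      then obtain m where j: "j = r k m" by blast
      from e have "Suc j \<in> I k" unfolding I_def escapes_def by auto
      then have "j < Max (I k)" using Max_ge[OF I] by fastforce
      then show False using r(3)[of k m] j by simp
    qed
    then show "finite {k. j \<in> range (r k)}" using finite_not_escapes finite_subset by blast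
  qed
qed

end

section \<open>Subsolutions that escape to infinity\<close>

context elliptic_manifold begin

lemma smooth_fun_mult: "smooth_fun \<A> f \<Longrightarrow> smooth_fun \<A> (\<lambda>p. t * f p)"
  using smooth_fun_linear_comb[of "{0::nat}" "\<lambda>_. f" "\<lambda>_. t"] by simp

lemma operator_mult: "smooth_fun \<A> f \<Longrightarrow> p \<in> topspace M \<Longrightarrow> A (\<lambda>p. t * f p) p = t * A f p"
  using operator_linear_comb_near[of "{0::nat}" "\<lambda>_. f" "\<lambda>p. t * f p" "topspace M" p "\<lambda>_. t"]
    smooth_fun_mult[of f t] by simp

lemma locally_finite_sum_nonneg: "(\<And>i p. 0 \<le> f i p) \<Longrightarrow> 0 \<le> locally_finite_sum f p"
  unfolding locally_finite_sum_def by (rule sum_nonneg) blast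

lemma locally_finite_sum_ge:
  assumes "\<And>i p. 0 \<le> f i p" and fin: "finite {i. f i p \<noteq> 0}"
  shows "f k p \<le> locally_finite_sum f p"
proof (cases "f k p = 0")
  case True
  then show ?thesis using locally_finite_sum_nonneg[of f p] assms(1) by simp
next
  case False
  then show ?thesis unfolding locally_finite_sum_def
    using assms by (intro member_le_sum) auto
qed

text \<open>
  The bad set of each barrier is repaired by the next barrier along the ray. The point \<open>q (Suc m)\<close> is chosen
  in \<open>W m \<inter> W (Suc m)\<close> and different from \<open>q m\<close>, and \<open>v (Suc m)\<close> is a barrier for the cell \<open>W m\<close> with bad set near
  \<open>q (Suc m)\<close>. The bad set \<open>G m\<close> of \<open>v m\<close> lies in \<open>W m\<close>, where \<open>v (Suc m)\<close> is bounded below, and it is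
  disjoint from the bad set of \<open>v (Suc m)\<close>. So a large multiple of \<open>v (Suc m)\<close> makes up for the defect of \<open>v m\<close>. The
  repair never ends, but it is pushed to infinity along the ray, and the infinite sum is locally
  finite.
\<close>

lemma escaping_subsolution:
  assumes cell: "\<And>m. barrier_cell (W m) (V m)"
    and adj: "\<And>m. W m \<inter> W (Suc m) \<noteq> {}"
    and lf: "\<And>p. p \<in> topspace M \<Longrightarrow> \<exists>N. openin M N \<and> p \<in> N \<and> finite {m::nat. N \<inter> V m \<noteq> {}}"
  obtains u \<eta> where "smooth_fun \<A> u" "\<And>p. 0 \<le> u p" "\<And>p. p \<notin> (\<Union>m. V m) \<Longrightarrow> u p = 0"
    "\<eta> > 0" "\<And>p. p \<in> W 0 \<Longrightarrow> \<eta> \<le> u p" "\<And>p. p \<in> topspace M \<Longrightarrow> u p \<le> A u p"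
proof -
  have Wo: "openin M (W m)" and Wne: "W m \<noteq> {}" and WV: "W m \<subseteq> V m"
    and single: "\<And>N q. openin M N \<Longrightarrow> N \<subseteq> W m \<Longrightarrow> N \<noteq> {q}" for m
    using cell[of m] unfolding barrier_cell_def by blast+
  have WM: "W m \<subseteq> topspace M" for m using Wo openin_subset by blast
  have "\<exists>q. \<forall>m. q m \<in> W m \<and> (q (Suc m) \<in> W m \<and> q (Suc m) \<noteq> q m)"
  proof (rule dependent_nat_choice)
    show "\<exists>x. x \<in> W 0" using Wne by blast
    fix x and m
    have "W m \<inter> W (Suc m) \<noteq> {x}" using single[of "W m \<inter> W (Suc m)" m x] Wo by blast
    then show "\<exists>y. y \<in> W (Suc m) \<and> y \<in> W m \<and> y \<noteq> x" using adj[of m] by blast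
  qed
  then obtain q where q: "\<And>m. q m \<in> W m" "\<And>m. q (Suc m) \<in> W m" "\<And>m. q (Suc m) \<noteq> q m" by blast
  have "\<forall>m. \<exists>E H. openin M E \<and> openin M H \<and> q m \<in> E \<and> q (Suc m) \<in> H \<and> E \<inter> H = {}"
  proof
    fix m
    have "q m \<in> topspace M" "q (Suc m) \<in> topspace M" "q m \<noteq> q (Suc m)"
      using q(1)[of m] q(1)[of "Suc m"] q(3)[of m] WM by auto
    then show "\<exists>E H. openin M E \<and> openin M H \<and> q m \<in> E \<and> q (Suc m) \<in> H \<and> E \<inter> H = {}"
      using Hausdorff unfolding Hausdorff_space_def disjnt_def by blast
  qed
  then obtain E H where EH: "\<And>m. openin M (E m)" "\<And>m. openin M (H m)" "\<And>m. q m \<in> E m"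
    "\<And>m. q (Suc m) \<in> H m" "\<And>m. E m \<inter> H m = {}"
    by metis
  \<comment> \<open>The index \<open>m - 1\<close> is \<open>0\<close> for \<open>m = 0\<close>: the first barrier uses the same cell as the second one.\<close>
  define G where "G m = E m \<inter> W m \<inter> (if m = 0 then topspace M else H (m - 1))" for m
  have Go: "openin M (G m)" for m unfolding G_def using EH(1,2) Wo by (simp add: openin_Int)
  have qG: "q m \<in> G m" for m
    unfolding G_def using EH(3) q(1) WM EH(4)[of "m - 1"] by (cases m) auto
  have GW: "G m \<subseteq> W m" for m unfolding G_def by blast
  have Gdisj: "p \<notin> G (Suc m)" if "p \<in> G m" for m p
    using that EH(5)[of m] unfolding G_def by auto
  have qW: "q m \<in> W (m - 1)" for m using q(1)[of 0] q(2) by (cases m) auto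
  have "\<forall>m. \<exists>v C \<eta>. smooth_fun \<A> v \<and> (\<forall>p. 0 \<le> v p) \<and> (\<forall>p. p \<notin> V (m - 1) \<longrightarrow> v p = 0) \<and>
        \<eta> > 0 \<and> (\<forall>p\<in>W (m - 1). \<eta> \<le> v p) \<and> C \<ge> 0 \<and> (\<forall>p\<in>topspace M. v p - C \<le> A v p) \<and>
        (\<forall>p\<in>topspace M - G m. 2 * v p \<le> A v p)" (is "\<forall>m. ?P m")
  proof
    fix m
    have "has_barriers (W (m - 1)) (V (m - 1))" using cell unfolding barrier_cell_def by blast
    from this[unfolded has_barriers_def, THEN spec, THEN spec, THEN mp, OF conjI[OF qW conjI[OF Go qG]]]
    show "?P m" .
  qed
  then obtain v C \<eta> where v: "\<And>m. smooth_fun \<A> (v m)" "\<And>m p. 0 \<le> v m p"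
    "\<And>m p. p \<notin> V (m - 1) \<Longrightarrow> v m p = 0" "\<And>m. \<eta> m > 0" "\<And>m p. p \<in> W (m - 1) \<Longrightarrow> \<eta> m \<le> v m p"
    "\<And>m. C m \<ge> (0 :: real)" "\<And>m p. p \<in> topspace M \<Longrightarrow> v m p - C m \<le> A (v m) p"
    "\<And>m p. p \<in> topspace M - G m \<Longrightarrow> 2 * v m p \<le> A (v m) p"
    by metis
  \<comment> \<open>The quotient makes the gain \<open>T (Suc m) * \<eta> (Suc m)\<close> outweigh the defect \<open>T m * C m\<close>; adding \<open>1\<close> keeps the
    weights positive when \<open>C m = 0\<close>.\<close>
  define T where "T = rec_nat 1 (\<lambda>m t. t * C m / \<eta> (Suc m) + 1)"
  have T0: "T 0 = 1" and TS: "T (Suc m) = T m * C m / \<eta> (Suc m) + 1" for m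
    by (simp_all add: T_def)
  have Tpos: "T m > 0" for m
  proof (induction m)
    case (Suc m)
    then have "0 \<le> T m * C m / \<eta> (Suc m)"
      using v(4)[of "Suc m"] v(6)[of m] by (intro divide_nonneg_pos mult_nonneg_nonneg) auto
    then show ?case by (simp add: TS)
  qed (simp add: T0)
  have T\<eta>: "T m * C m \<le> T (Suc m) * \<eta> (Suc m)" for m
    using v(4)[of "Suc m"] by (simp add: TS field_simps)
  define f where "f m p = T m * v m p" for m p
  have f_smooth: "smooth_fun \<A> (f m)" for m
    unfolding f_def[abs_def] by (rule smooth_fun_mult[OF v(1)])
  have Af: "A (f m) p = T m * A (v m) p" if "p \<in> topspace M" for m p
    unfolding f_def[abs_def] by (rule operator_mult[OF v(1) that])
  have f_nonneg: "0 \<le> f m p" for m p using v(2) Tpos[of m] by (simp add: f_def)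
  have f_lf: "\<exists>N. openin M N \<and> p \<in> N \<and> finite {m. \<exists>q\<in>N. f m q \<noteq> 0}" if p: "p \<in> topspace M" for p
  proof -
    obtain N where N: "openin M N" "p \<in> N" "finite {m. N \<inter> V m \<noteq> {}}" using lf[OF p] by blast
    have "{m. \<exists>q\<in>N. f m q \<noteq> 0} \<subseteq> insert 0 (Suc ` {m. N \<inter> V m \<noteq> {}})"
    proof
      fix m assume "m \<in> {m. \<exists>q\<in>N. f m q \<noteq> 0}"
      then obtain q where q: "q \<in> N" "v m q \<noteq> 0" unfolding f_def by auto
      then have "N \<inter> V (m - 1) \<noteq> {}" using v(3)[of q m] by blast
      then show "m \<in> insert 0 (Suc ` {m. N \<inter> V m \<noteq> {}})" by (cases m) auto
    qed
    then have "finite {m. \<exists>q\<in>N. f m q \<noteq> 0}" using N(3) finite_subset by blast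
    with N show ?thesis by blast
  qed
  let ?u = "locally_finite_sum f"
  \<comment> \<open>At a given point the defect of the last term is the only one that has not been repaired: if the point lies
    in \<open>G (Suc n)\<close>, then it is not in \<open>G n\<close>.\<close>
  have partial_sum: "(if p \<in> G n then - (T n * C n) else 0) \<le> (\<Sum>i<Suc n. A (f i) p - f i p)"
    if p: "p \<in> topspace M" for p n
  proof (induction n)
    have low: "- (T n * C n) \<le> A (f n) p - f n p" for n
    proof -
      have "T n * (v n p - C n) \<le> T n * A (v n) p"
        using v(7)[OF p] Tpos[of n] by (intro mult_left_mono) auto
      then show ?thesis unfolding Af[OF p] f_def by (simp add: algebra_simps)
    qed
    have good: "f n p \<le> A (f n) p - f n p" if "p \<notin> G n" for n
    proof -
      have "T n * (2 * v n p) \<le> T n * A (v n) p"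
        using v(8)[of p n] p that Tpos[of n] by (intro mult_left_mono) auto
      then show ?thesis unfolding Af[OF p] f_def by simp
    qed
    {
      case 0
      show ?case using low[of 0] good[of 0] f_nonneg[of 0 p] by auto
    next
      case (Suc n)
      show ?case
      proof (cases "p \<in> G (Suc n)")
        case True
        then have "p \<notin> G n" using Gdisj by blast
        then have "0 \<le> (\<Sum>i<Suc n. A (f i) p - f i p)" using Suc by simp
        then show ?thesis using low[of "Suc n"] True by simp
      next
        case False
        have "(if p \<in> G n then T n * C n else 0) \<le> f (Suc n) p"
        proof (cases "p \<in> G n")
          case True
          then have "\<eta> (Suc n) \<le> v (Suc n) p" using GW v(5)[of p "Suc n"] by auto
          then have "T (Suc n) * \<eta> (Suc n) \<le> f (Suc n) p"
            unfolding f_def using Tpos[of "Suc n"] by (intro mult_left_mono) auto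
          then show ?thesis using T\<eta>[of n] True by simp
        qed (simp add: f_nonneg)
        then show ?thesis using Suc good[OF False] False by (auto split: if_splits)
      qed
    }
  qed
  show thesis
  proof (rule that)
    show "smooth_fun \<A> ?u" by (rule smooth_locally_finite_sum[OF f_smooth f_lf])
    show "0 \<le> ?u p" for p by (rule locally_finite_sum_nonneg[OF f_nonneg])
    show "?u p = 0" if "p \<notin> (\<Union>m. V m)" for p
    proof -
      have "f i p = 0" for i using v(3) that by (simp add: f_def)
      then show ?thesis by (simp add: locally_finite_sum_def)
    qed
    show "\<eta> 0 > 0" by (rule v(4))
    show "\<eta> 0 \<le> ?u p" if p: "p \<in> W 0" for p
    proof -
      obtain N where "p \<in> N" "finite {m. \<exists>q\<in>N. f m q \<noteq> 0}" using f_lf p WM by blast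
      then have "finite {m. f m p \<noteq> 0}" by (auto elim!: finite_subset[rotated])
      then have "f 0 p \<le> ?u p" by (rule locally_finite_sum_ge[OF f_nonneg])
      moreover have "\<eta> 0 \<le> f 0 p" using v(5)[of p 0] p by (simp add: f_def T0)
      ultimately show ?thesis by linarith
    qed
    show "?u p \<le> A ?u p" if p: "p \<in> topspace M" for p
    proof -
      obtain n where n: "\<And>m. m \<ge> n \<Longrightarrow> ?u p = (\<Sum>i<m. f i p)"
        "\<And>m. m \<ge> n \<Longrightarrow> A ?u p = (\<Sum>i<m. A (f i) p)"
        using operator_locally_finite_sum[OF f_smooth f_lf p] by metis
      obtain N where "p \<in> N" "finite {m. N \<inter> V m \<noteq> {}}" using lf p by blast
      then have "finite {m. p \<in> V m}" by (auto elim!: finite_subset[rotated])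
      then have "finite {m. p \<in> G m}" by (rule finite_subset[rotated]) (use GW WV in blast)
      then obtain l where l: "{m. p \<in> G m} \<subseteq> {..<l}" using finite_nat_iff_bounded by blast
      \<comment> \<open>Far out along the ray the point lies in no bad set, so nothing is left to repair.\<close>
      define m where "m = max n l"
      have "p \<notin> G m" using l unfolding m_def by (metis (mono_tags) lessThan_iff max.cobounded2 mem_Collect_eq not_le subsetD)
      then have "0 \<le> (\<Sum>i<Suc m. A (f i) p - f i p)" using partial_sum[OF p, of m] by simp
      also have "\<dots> = A ?u p - ?u p"
        using n[of "Suc m"] unfolding m_def by (simp add: sum_subtractf del: sum.lessThan_Suc)
      finally show ?thesis by simp
    qed
  qed
qed

text \<open>
  Start a ray at each cell of a locally finite cover and add up large multiples of the corresponding
  subsolutions. As \<open>A u \<ge> u \<ge> 0\<close> holds for each of them on the whole manifold, the multiples can be chosen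
  independently of each other: no term can spoil what another one has achieved. Also \<open>A \<phi> \<ge> \<phi>\<close> for the sum, so only
  \<open>\<phi> > \<rho>\<close> has to be arranged.
\<close>

lemma large_subsolution_exists:
  assumes "connected_space M" "\<not> compact_space M" and \<rho>: "continuous_map M euclideanreal \<rho>"
  shows "\<exists>\<phi>. smooth_fun \<A> \<phi> \<and> (\<forall>p\<in>topspace M. \<phi> p > \<rho> p \<and> A \<phi> p > \<rho> p)"
proof -
  have cell_small: "\<exists>W V. barrier_cell W V \<and> p \<in> W \<and> V \<subseteq> N" if "openin M N" "p \<in> N" for N p
    using barrier_cell_exists[OF that] by metis
  obtain W V :: "nat \<Rightarrow> 'm set" where cell: "\<And>n. barrier_cell (W n) (V n)"
    and cover: "(\<Union>n. W n) = topspace M"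
    and lf: "\<And>p. p \<in> topspace M \<Longrightarrow> \<exists>N. openin M N \<and> p \<in> N \<and> finite {n. N \<inter> V n \<noteq> {}}"
  proof (rule locally_finite_cell_cover[OF second_countable Hausdorff assms(2), of barrier_cell])
    show "openin M W \<and> W \<subseteq> V \<and> (\<exists>K. compactin M K \<and> V \<subseteq> K)" if "barrier_cell W V" for W V
      using that unfolding barrier_cell_def by blast
  qed (use cell_small in auto)
  have Wo: "openin M (W n)" and Wne: "W n \<noteq> {}" and WV: "W n \<subseteq> V n"
    and Vc: "\<exists>K. compactin M K \<and> V n \<subseteq> K" for n
    using cell[of n] unfolding barrier_cell_def by blast+
  have meets_finite: "finite {n. K \<inter> V n \<noteq> {}}" if K: "compactin M K" for K
  proof -
    obtain N where N: "\<And>p. p \<in> topspace M \<Longrightarrow> openin M (N p) \<and> p \<in> N p \<and> finite {n. N p \<inter> V n \<noteq> {}}"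
      using lf by metis
    have KM: "K \<subseteq> topspace M" by (rule compactin_subset_topspace[OF K])
    have "\<forall>U\<in>N ` K. openin M U" "K \<subseteq> \<Union>(N ` K)" using N KM by auto
    then obtain \<F> where \<F>: "finite \<F>" "\<F> \<subseteq> N ` K" "K \<subseteq> \<Union>\<F>"
      using K unfolding compactin_def by metis
    have "finite (\<Union>U\<in>\<F>. {n. U \<inter> V n \<noteq> {}})" using \<F>(1,2) N KM by (intro finite_UN_I) auto
    moreover have "{n. K \<inter> V n \<noteq> {}} \<subseteq> (\<Union>U\<in>\<F>. {n. U \<inter> V n \<noteq> {}})" using \<F>(3) by fastforce
    ultimately show ?thesis by (rule finite_subset[rotated])
  qed
  \<comment> \<open>The nerve of the cover is connected because the manifold is, and locally finite because each
    cell lies in a compact set.\<close>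
  interpret graph: connected_locally_finite_graph "\<lambda>m n. W m \<inter> W n \<noteq> {}"
  proof
    show "W n \<inter> W m \<noteq> {}" if "W m \<inter> W n \<noteq> {}" for m n using that by blast
    show "finite {m. W n \<inter> W m \<noteq> {}}" for n
    proof -
      obtain K where K: "compactin M K" "V n \<subseteq> K" using Vc by blast
      have "{m. W n \<inter> W m \<noteq> {}} \<subseteq> {m. K \<inter> V m \<noteq> {}}"
        using K(2) WV[of n] WV by fastforce
      then show ?thesis using meets_finite[OF K(1)] by (rule finite_subset)
    qed
    fix S :: "nat set"
    assume S: "S \<noteq> {}" "\<And>m n. m \<in> S \<Longrightarrow> W m \<inter> W n \<noteq> {} \<Longrightarrow> n \<in> S"
    show "S = UNIV"
    proof (rule ccontr)
      assume "S \<noteq> UNIV"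
      then obtain m n where mn: "m \<in> S" "n \<notin> S" using S(1) by blast
      let ?E = "\<Union>(W ` S)" and ?F = "\<Union>(W ` (- S))"
      have "openin M ?E" "openin M ?F" using Wo by auto
      moreover have "topspace M \<subseteq> ?E \<union> ?F" unfolding cover[symmetric] by blast
      moreover have "?E \<inter> ?F = {}"
      proof (rule ccontr)
        assume "?E \<inter> ?F \<noteq> {}"
        then obtain i j where "i \<in> S" "j \<in> - S" "W i \<inter> W j \<noteq> {}" by blast
        then show False using S(2)[of i j] by blast
      qed
      moreover have "?E \<noteq> {}" "?F \<noteq> {}" using mn Wne[of m] Wne[of n] by auto
      ultimately show False using assms(1) unfolding connected_space_def by blast
    qed
  qed
  obtain r where "(\<forall>k. r k 0 = k) \<and> (\<forall>k m. W (r k m) \<inter> W (r k (Suc m)) \<noteq> {}) \<and>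
      (\<forall>k. inj (r k)) \<and> (\<forall>j. finite {k. j \<in> range (r k)})"
    by (rule exE[OF graph.locally_finite_rays])
  then have r: "r k 0 = k" "W (r k m) \<inter> W (r k (Suc m)) \<noteq> {}" "inj (r k)" "finite {k. j \<in> range (r k)}"
    for k m j by blast+
  have "\<forall>k. \<exists>u \<eta>. smooth_fun \<A> u \<and> (\<forall>p. 0 \<le> u p) \<and> (\<forall>p. p \<notin> (\<Union>m. V (r k m)) \<longrightarrow> u p = 0) \<and>
    \<eta> > 0 \<and> (\<forall>p\<in>W k. \<eta> \<le> u p) \<and> (\<forall>p\<in>topspace M. u p \<le> A u p)"
  proof
    fix k
    have lf': "\<exists>N. openin M N \<and> p \<in> N \<and> finite {m. N \<inter> V (r k m) \<noteq> {}}" if "p \<in> topspace M" for p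
    proof -
      obtain N where N: "openin M N" "p \<in> N" "finite {n. N \<inter> V n \<noteq> {}}" using lf \<open>p \<in> topspace M\<close> by blast
      have "finite (r k -` {n. N \<inter> V n \<noteq> {}})" by (rule finite_vimageI[OF N(3) r(3)])
      moreover have "r k -` {n. N \<inter> V n \<noteq> {}} = {m. N \<inter> V (r k m) \<noteq> {}}" by blast
      ultimately show ?thesis using N(1,2) by auto
    qed
    obtain u \<eta> where "smooth_fun \<A> u" "\<And>p. 0 \<le> u p" "\<And>p. p \<notin> (\<Union>m. V (r k m)) \<Longrightarrow> u p = 0"
      "\<eta> > 0" "\<And>p. p \<in> W (r k 0) \<Longrightarrow> \<eta> \<le> u p" "\<And>p. p \<in> topspace M \<Longrightarrow> u p \<le> A u p"
      using escaping_subsolution[of "\<lambda>m. W (r k m)" "\<lambda>m. V (r k m)", OF cell r(2) lf'] by metis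
    then show "\<exists>u \<eta>. smooth_fun \<A> u \<and> (\<forall>p. 0 \<le> u p) \<and> (\<forall>p. p \<notin> (\<Union>m. V (r k m)) \<longrightarrow> u p = 0) \<and>
      \<eta> > 0 \<and> (\<forall>p\<in>W k. \<eta> \<le> u p) \<and> (\<forall>p\<in>topspace M. u p \<le> A u p)"
      unfolding r(1) by (intro exI[of _ u] exI[of _ \<eta>]) simp
  qed
  then obtain u \<eta> where u: "\<And>k. smooth_fun \<A> (u k)" "\<And>k p. 0 \<le> u k p"
    "\<And>k p. p \<notin> (\<Union>m. V (r k m)) \<Longrightarrow> u k p = 0" "\<And>k. \<eta> k > 0" "\<And>k p. p \<in> W k \<Longrightarrow> \<eta> k \<le> u k p"
    "\<And>k p. p \<in> topspace M \<Longrightarrow> u k p \<le> A (u k) p"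
    by metis
  have "\<exists>B. \<forall>p\<in>W k. \<rho> p \<le> B" for k
  proof -
    obtain K where K: "compactin M K" "V k \<subseteq> K" using Vc by blast
    then have "compact (\<rho> ` K)" using image_compactin[OF K(1) \<rho>] by simp
    then have "bounded (\<rho> ` K)" by (rule compact_imp_bounded)
    then obtain B where "\<forall>y\<in>\<rho> ` K. norm y \<le> B" unfolding bounded_iff by blast
    then have "\<forall>p\<in>W k. \<rho> p \<le> B" using K(2) WV[of k] by (auto dest!: bspec)
    then show ?thesis ..
  qed
  then obtain B where B: "\<And>k p. p \<in> W k \<Longrightarrow> \<rho> p \<le> B k" by metis
  define c where "c k = (\<bar>B k\<bar> + 1) / \<eta> k" for k
  have c: "c k > 0" for k using u(4)[of k] by (simp add: c_def)
  define f where "f k p = c k * u k p" for k p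
  have f_smooth: "smooth_fun \<A> (f k)" for k
    unfolding f_def[abs_def] by (rule smooth_fun_mult[OF u(1)])
  have f_nonneg: "0 \<le> f k p" for k p using u(2) c[of k] by (simp add: f_def)
  have Af: "f k p \<le> A (f k) p" if "p \<in> topspace M" for k p
    unfolding f_def[abs_def] operator_mult[OF u(1) that] using u(6)[OF that] c[of k]
    by (intro mult_left_mono) auto
  have f_lf: "\<exists>N. openin M N \<and> p \<in> N \<and> finite {k. \<exists>q\<in>N. f k q \<noteq> 0}" if p: "p \<in> topspace M" for p
  proof -
    obtain N where N: "openin M N" "p \<in> N" "finite {n. N \<inter> V n \<noteq> {}}" using lf[OF p] by blast
    have "{k. \<exists>q\<in>N. f k q \<noteq> 0} \<subseteq> (\<Union>n\<in>{n. N \<inter> V n \<noteq> {}}. {k. n \<in> range (r k)})"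
    proof
      fix k assume "k \<in> {k. \<exists>q\<in>N. f k q \<noteq> 0}"
      then obtain q where q: "q \<in> N" "u k q \<noteq> 0" unfolding f_def by auto
      then obtain m where "q \<in> V (r k m)" using u(3)[of q k] by blast
      then show "k \<in> (\<Union>n\<in>{n. N \<inter> V n \<noteq> {}}. {k. n \<in> range (r k)})" using q(1) by blast
    qed
    moreover have "finite (\<Union>n\<in>{n. N \<inter> V n \<noteq> {}}. {k. n \<in> range (r k)})"
      using N(3) r(4) by blast
    ultimately have "finite {k. \<exists>q\<in>N. f k q \<noteq> 0}" by (rule finite_subset)
    with N show ?thesis by blast
  qed
  let ?\<phi> = "locally_finite_sum f"
  have large: "\<rho> p < ?\<phi> p" if p: "p \<in> topspace M" for p
  proof -
    obtain k where k: "p \<in> W k" using p cover by blast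
    obtain N where "p \<in> N" "finite {m. \<exists>q\<in>N. f m q \<noteq> 0}" using f_lf p by blast
    then have "finite {m. f m p \<noteq> 0}" by (auto elim!: finite_subset[rotated])
    then have "f k p \<le> ?\<phi> p" by (rule locally_finite_sum_ge[OF f_nonneg])
    moreover have "c k * \<eta> k \<le> f k p"
      unfolding f_def using u(5)[OF k] c[of k] by (intro mult_left_mono) auto
    moreover have "c k * \<eta> k = \<bar>B k\<bar> + 1" using u(4)[of k] by (simp add: c_def)
    ultimately show ?thesis using B[OF k] by linarith
  qed
  moreover have "?\<phi> p \<le> A ?\<phi> p" if p: "p \<in> topspace M" for p
  proof -
    obtain n where n: "\<And>m. m \<ge> n \<Longrightarrow> ?\<phi> p = (\<Sum>i<m. f i p)"
      "\<And>m. m \<ge> n \<Longrightarrow> A ?\<phi> p = (\<Sum>i<m. A (f i) p)"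
      using operator_locally_finite_sum[OF f_smooth f_lf p] by metis
    show ?thesis using n[of n] sum_mono[of "{..<n}" "\<lambda>i. f i p" "\<lambda>i. A (f i) p"] Af[OF p] by simp
  qed
  moreover have "smooth_fun \<A> ?\<phi>" by (rule smooth_locally_finite_sum[OF f_smooth f_lf])
  ultimately show ?thesis by (intro exI[of _ ?\<phi>]) fastforce
qed

end

theorem theorem1p1:
  fixes M :: "'m topology"
    and \<A> :: "('m, 'n::finite) chart set"
    and A :: "('m \<Rightarrow> real) \<Rightarrow> 'm \<Rightarrow> real"
    and \<rho> :: "'m \<Rightarrow> real"
  assumes "smooth_manifold M \<A>"
    and "connected_space M"
    and "\<not> compact_space M"
    and "elliptic_operator \<A> A"
    and "continuous_map M euclideanreal \<rho>"
    and "\<forall>p\<in>topspace M. \<rho> p > 0"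
  shows "\<exists>\<phi>. smooth_fun \<A> \<phi> \<and> (\<forall>p\<in>topspace M. \<phi> p > \<rho> p \<and> A \<phi> p > \<rho> p)"
proof -
  interpret elliptic_manifold M \<A> A
    using assms by unfold_locales
  show ?thesis using assms by (intro large_subsolution_exists)
qed

end
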